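(* Let $n\ge 8$ and $t>0$. Suppose that for every stable lattice $\Lambda\subset\mathbb{R}^n$ we have an even Schwartz function $h_\Lambda:\mathbb{R}^n\to\mathbb{R}$ such that: (a) $h_{U\Lambda}=h_\Lambda$ (as functions on $\mathbb{R}^n$) for every $U\in O(n)$ and every stable $\Lambda$; (b) $h_\Lambda(x)\ge e^{-t\|x\|^2}$ for every nonzero $x\in\Lambda$ and every stable $\Lambda$; (c) $\widehat h_\Lambda(\xi)\le 0$ for every nonzero $\xi\in\Lambda^*$ and every stable $\Lambda$. If $1+\widehat h_{\mathbb{Z}^n}(0)-h_{\mathbb{Z}^n}(0)=\Theta_{\mathbb{Z}^n}(t)$, then, for $\Lambda_c=E_8\oplus\mathbb{Z}^{n-8}$, $$1+\widehat h_{\Lambda_c}(0)-h_{\Lambda_c}(0)>\Theta_{\mathbb{Z}^n}(t).$$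
   Context: A full-rank lattice $\Lambda\subset\mathbb{R}^n$ is stable if $\operatorname{covol}(\Lambda)=1$ and every nonzero sublattice $\Lambda'\subseteq\Lambda$ (of any rank) has covolume at least $1$ in its linear span; equivalently, if $v_1,\dots,v_r$ is a basis of $\Lambda'$, then $\sqrt{\det(\langle v_i,v_j\rangle)_{i,j=1}^r}\ge 1$. The lattices $\mathbb{Z}^n$ and $E_8\oplus\mathbb{Z}^{n-8}$ are stable. The dual lattice is $\Lambda^*=\{\xi\in\mathbb{R}^n:\langle x,\xi\rangle\in\mathbb{Z}\text{ for all }x\in\Lambda\}$. The Gaussian mass of $\Lambda$ is $\Theta_\Lambda(t)=\sum_{x\in\Lambda}e^{-t\|x\|^2}$ for $t>0$. The Fourier transform is $\widehat f(\xi)=\int_{\mathbb{R}^n}f(x)e^{-2\pi i\langle x,\xi\rangle}\,dx$; for $h$ real and even, $\widehat h$ is real-valued. $E_8=D_8\cup\bigl(D_8+(1/2,\ldots,1/2)\bigr)\subset\mathbb{R}^8$ with $D_8=\{x\in\mathbb{Z}^8:x_1+\cdots+x_8\equiv 0 \pmod 2\}$; $\oplus$ is the orthogonal direct sum (inside $\mathbb{R}^8\times\mathbb{R}^{n-8}=\mathbb{R}^n$), and $\mathbb{Z}^0=\{0\}$. $O(n)$ is the orthogonal group, and $U\Lambda=\{Ux:x\in\Lambda\}$. *)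

theory Defs
  imports "HOL-Analysis.Analysis" "Jordan_Normal_Form.Determinant"
begin

no_notation vec_index (infixl \<open>$\<close> 100)

definition int_combs :: "'a::real_vector list \<Rightarrow> 'a set" where
  "int_combs vs = {\<Sum>i<length vs. of_int (c i) *\<^sub>R vs ! i |c :: nat \<Rightarrow> int. True}"

definition lattice_basis :: "'a::real_vector list \<Rightarrow> 'a set \<Rightarrow> bool" where
  "lattice_basis vs L \<longleftrightarrow> distinct vs \<and> independent (set vs) \<and> L = int_combs vs"

text \<open>Lattices of arbitrary rank; the zero lattice has the empty basis.\<close>

definition is_lattice :: "'a::real_vector set \<Rightarrow> bool" where
  "is_lattice L \<longleftrightarrow> (\<exists>vs. lattice_basis vs L)"

definition full_rank_lattice :: "'a::real_vector set \<Rightarrow> bool" where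
  "full_rank_lattice L \<longleftrightarrow> (\<exists>vs. lattice_basis vs L \<and> span (set vs) = UNIV)"

definition gram :: "'a::real_inner list \<Rightarrow> real mat" where
  "gram vs = mat (length vs) (length vs) (\<lambda>(i, j). vs ! i \<bullet> vs ! j)"

text \<open>The covolume of a lattice in its linear span. The choice of basis is
  immaterial, see \<open>covolume_eq\<close> below.\<close>

definition covolume :: "'a::real_inner set \<Rightarrow> real" where
  "covolume L = sqrt (Determinant.det (gram (SOME vs. lattice_basis vs L)))"

lemma lattice_basis_mem:
  assumes "lattice_basis vs L" "i < length vs"
  shows "vs ! i \<in> L"
proof -
  define c :: "nat \<Rightarrow> int" where "c = (\<lambda>j. if j = i then 1 else 0)"
  have "(\<Sum>j<length vs. of_int (c j) *\<^sub>R vs ! j) = (\<Sum>j<length vs. if j = i then vs ! j else 0)"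
    by (intro sum.cong) (auto simp: c_def)
  also have "\<dots> = vs ! i"
    using assms(2) by simp
  finally have "vs ! i \<in> int_combs vs"
    unfolding int_combs_def by (intro CollectI exI[of _ c]) simp
  then show ?thesis
    using assms(1) by (simp add: lattice_basis_def)
qed

lemma span_lattice_basis:
  assumes "lattice_basis vs L"
  shows "span (set vs) = span L"
proof
  show "span (set vs) \<subseteq> span L"
    by (intro span_mono) (auto simp: in_set_conv_nth intro: lattice_basis_mem[OF assms])
  have "L \<subseteq> span (set vs)"
    using assms unfolding lattice_basis_def int_combs_def
    by (auto intro!: span_sum span_scale[OF span_base] nth_mem)
  then show "span L \<subseteq> span (set vs)"
    by (simp add: span_minimal)
qed

lemma independent_list_coeffs:
  fixes c :: "nat \<Rightarrow> real"
  assumes "distinct vs" "independent (set vs)"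
    and "(\<Sum>i<length vs. c i *\<^sub>R vs ! i) = 0" "i < length vs"
  shows "c i = 0"
proof -
  have bij: "bij_betw ((!) vs) {..<length vs} (set vs)"
    using bij_betw_nth[OF assms(1), of "{..<length vs}" "set vs"] by simp
  define g where "g = the_inv_into {..<length vs} ((!) vs)"
  have g: "g (vs ! j) = j" if "j < length vs" for j
    using that bij unfolding g_def bij_betw_def by (simp add: the_inv_into_f_f)
  have "(\<Sum>v\<in>set vs. c (g v) *\<^sub>R v) = (\<Sum>i<length vs. c (g (vs ! i)) *\<^sub>R vs ! i)"
    by (rule sum.reindex_bij_betw[OF bij, symmetric])
  also have "\<dots> = 0"
    using assms(3) by (simp add: g)
  finally have "\<forall>v\<in>set vs. c (g v) = 0"
    using real_vector.independentD[OF assms(2) finite_set subset_refl, of "\<lambda>v. c (g v)"] by blast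
  then show ?thesis
    using g[OF assms(4)] assms(4) by (metis nth_mem)
qed

lemma det_gram_eq:
  fixes vs ws :: "'a::real_inner list"
  assumes v: "lattice_basis vs L" and w: "lattice_basis ws L"
  shows "Determinant.det (gram vs) = Determinant.det (gram ws)"
proof -
  define n where "n = length vs"
  have "card (set vs) = dim L" "card (set ws) = dim L"
    using v w real_vector.dim_eq_card[of "set vs" L] real_vector.dim_eq_card[of "set ws" L]
    by (simp_all add: lattice_basis_def[of vs] lattice_basis_def[of ws]
        span_lattice_basis[OF v] span_lattice_basis[OF w])
  then have "length vs = dim L" "length ws = dim L"
    using v w by (simp_all add: lattice_basis_def distinct_card)
  then have lw: "length ws = n" and lv: "length vs = n"
    by (simp_all add: n_def)
  have "\<forall>i<n. \<exists>c::nat \<Rightarrow> int. vs ! i = (\<Sum>j<n. of_int (c j) *\<^sub>R ws ! j)"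
    using lattice_basis_mem[OF v] w lw lv unfolding lattice_basis_def int_combs_def by auto
  then obtain p :: "nat \<Rightarrow> nat \<Rightarrow> int"
    where p: "\<And>i. i < n \<Longrightarrow> vs ! i = (\<Sum>j<n. of_int (p i j) *\<^sub>R ws ! j)"
    by metis
  have "\<forall>i<n. \<exists>c::nat \<Rightarrow> int. ws ! i = (\<Sum>j<n. of_int (c j) *\<^sub>R vs ! j)"
    using lattice_basis_mem[OF w] v lw lv unfolding lattice_basis_def int_combs_def by auto
  then obtain q :: "nat \<Rightarrow> nat \<Rightarrow> int"
    where q: "\<And>i. i < n \<Longrightarrow> ws ! i = (\<Sum>j<n. of_int (q i j) *\<^sub>R vs ! j)"
    by metis
  have pq: "(\<Sum>j<n. p i j * q j k) = (if i = k then 1 else 0)" if ik: "i < n" "k < n" for i k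
  proof -
    define c :: "nat \<Rightarrow> real"
      where "c = (\<lambda>k. of_int (\<Sum>j<n. p i j * q j k) - (if i = k then 1 else 0))"
    have "vs ! i = (\<Sum>j<n. of_int (p i j) *\<^sub>R (\<Sum>k<n. of_int (q j k) *\<^sub>R vs ! k))"
      using p[OF ik(1)] q by simp
    also have "\<dots> = (\<Sum>k<n. of_int (\<Sum>j<n. p i j * q j k) *\<^sub>R vs ! k)"
      (is "?l = ?r")
    proof -
      have "?l = (\<Sum>j<n. \<Sum>k<n. of_int (p i j * q j k) *\<^sub>R vs ! k)"
        by (simp add: scaleR_sum_right)
      also have "\<dots> = (\<Sum>k<n. \<Sum>j<n. of_int (p i j * q j k) *\<^sub>R vs ! k)"
        by (rule sum.swap)
      also have "\<dots> = ?r"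
        by (simp add: scaleR_sum_left)
      finally show ?thesis .
    qed
    finally have a: "vs ! i = (\<Sum>k<n. of_int (\<Sum>j<n. p i j * q j k) *\<^sub>R vs ! k)" .
    have b: "(\<Sum>k<n. (if i = k then 1 else 0) *\<^sub>R vs ! k) = vs ! i"
    proof -
      have "(\<Sum>k<n. (if i = k then 1 else 0) *\<^sub>R vs ! k) = (\<Sum>k<n. if i = k then vs ! k else 0)"
        by (intro sum.cong) auto
      then show ?thesis using ik by simp
    qed
    have "(\<Sum>k<n. c k *\<^sub>R vs ! k) = 0"
      unfolding c_def scaleR_left_diff_distrib sum_subtractf b using a by simp
    then have "c k = 0"
      using independent_list_coeffs[of vs c k] v ik lv unfolding lattice_basis_def by simp
    then show ?thesis
      unfolding c_def by (cases "i = k") (simp_all flip: of_int_sum of_int_mult)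
  qed
  define P where "P = mat n n (\<lambda>(i, j). p i j)"
  define Q where "Q = mat n n (\<lambda>(i, j). q i j)"
  have PQc: "P \<in> carrier_mat n n" "Q \<in> carrier_mat n n"
    by (simp_all add: P_def Q_def)
  have "P * Q = 1\<^sub>m n"
    using pq by (intro eq_matI) (auto simp: P_def Q_def scalar_prod_def atLeast0LessThan)
  then have "Determinant.det P * Determinant.det Q = 1"
    using Determinant.det_mult[OF PQc] by simp
  then have d: "Determinant.det P = 1 \<or> Determinant.det P = - 1"
    using pos_zmult_eq_1_iff_lemma by blast
  define R where "R = map_mat (of_int :: int \<Rightarrow> real) P"
  have R: "R \<in> carrier_mat n n" and Rt: "transpose_mat R \<in> carrier_mat n n"
    by (simp_all add: R_def P_def)
  have G: "gram ws \<in> carrier_mat n n"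
    by (simp add: gram_def lw)
  have Rij: "R $$ (i, j) = of_int (p i j)" if "i < n" "j < n" for i j
    using that by (simp add: R_def P_def)
  have detR: "Determinant.det R = of_int (Determinant.det P)"
    unfolding R_def by simp
  have "gram vs = R * (gram ws * transpose_mat R)"
  proof (rule eq_matI)
    fix i j assume "i < dim_row (R * (gram ws * transpose_mat R))"
      "j < dim_col (R * (gram ws * transpose_mat R))"
    then have ij: "i < n" "j < n"
      by (simp_all add: R_def P_def)
    have "gram vs $$ (i, j) = (\<Sum>k<n. of_int (p i k) *\<^sub>R ws ! k) \<bullet> (\<Sum>l<n. of_int (p j l) *\<^sub>R ws ! l)"
      using p ij by (simp add: gram_def lv)
    also have "\<dots> = (\<Sum>k<n. of_int (p i k) * (\<Sum>l<n. (ws ! k \<bullet> ws ! l) * of_int (p j l)))"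
      unfolding inner_sum_left
      by (simp add: inner_sum_right sum_distrib_left mult_ac)
    also have "\<dots> = (R * (gram ws * transpose_mat R)) $$ (i, j)"
      using ij R G by (simp add: scalar_prod_def atLeast0LessThan Rij gram_def lw)
    finally show "gram vs $$ (i, j) = (R * (gram ws * transpose_mat R)) $$ (i, j)" .
  qed (simp_all add: gram_def lv R_def P_def)
  then have "Determinant.det (gram vs)
      = Determinant.det R * (Determinant.det (gram ws) * Determinant.det R)"
    using Determinant.det_mult[OF R mult_carrier_mat[OF G Rt]] Determinant.det_mult[OF G Rt]
      Determinant.det_transpose[OF R] by simp
  then show ?thesis
    using d unfolding detR by auto
qed

lemma covolume_eq:
  assumes "lattice_basis vs L"
  shows "covolume L = sqrt (Determinant.det (gram vs))"
  unfolding covolume_def by (metis assms det_gram_eq someI)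

definition stable :: "'a::euclidean_space set \<Rightarrow> bool" where
  "stable L \<longleftrightarrow> full_rank_lattice L \<and> covolume L = 1 \<and>
     (\<forall>M. is_lattice M \<longrightarrow> M \<subseteq> L \<longrightarrow> M \<noteq> {0} \<longrightarrow> covolume M \<ge> 1)"

definition dual_lattice :: "'a::real_inner set \<Rightarrow> 'a set" where
  "dual_lattice L = {\<xi>. \<forall>x\<in>L. x \<bullet> \<xi> \<in> \<int>}"

definition gaussian_mass :: "'a::real_normed_vector set \<Rightarrow> real \<Rightarrow> real" where
  "gaussian_mass L t = (\<Sum>\<^sub>\<infinity>x\<in>L. exp (- t * (norm x)\<^sup>2))"

definition int_lattice :: "(real^'n) set" where
  "int_lattice = {x. \<forall>i. x $ i \<in> \<int>}"

definition D8 :: "(real^8) set" where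
  "D8 = {x. (\<forall>i. x $ i \<in> \<int>) \<and> (\<exists>k::int. (\<Sum>i\<in>UNIV. x $ i) = 2 * of_int k)}"

definition E8 :: "(real^8) set" where
  "E8 = D8 \<union> (\<lambda>x. x + (\<chi> i. 1/2)) ` D8"

text \<open>The orthogonal direct sum of \<open>E8\<close> and the integer lattice in the remaining coordinates.
  The injection \<open>e\<close> says which eight coordinates (in which order) make up the factor
  \<open>real^8\<close>; if \<open>e\<close> is surjective, this is just a copy of \<open>E8\<close>.\<close>

definition E8_sum_int :: "(8 \<Rightarrow> 'n) \<Rightarrow> (real^'n) set" where
  "E8_sum_int e = {x. (\<chi> i. x $ e i) \<in> E8 \<and> (\<forall>j. j \<notin> range e \<longrightarrow> x $ j \<in> \<int>)}"

definition partial_deriv :: "'n \<Rightarrow> (real^'n \<Rightarrow> real) \<Rightarrow> real^'n \<Rightarrow> real" where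
  "partial_deriv i f x = frechet_derivative f (at x) (axis i 1)"

fun iter_partial_deriv :: "'n list \<Rightarrow> (real^'n \<Rightarrow> real) \<Rightarrow> real^'n \<Rightarrow> real" where
  "iter_partial_deriv [] f = f"
| "iter_partial_deriv (i # js) f = partial_deriv i (iter_partial_deriv js f)"

text \<open>Smoothness is expressed as total differentiability of all iterated partial derivatives.\<close>

definition schwartz :: "(real^'n \<Rightarrow> real) \<Rightarrow> bool" where
  "schwartz f \<longleftrightarrow>
     (\<forall>js x. iter_partial_deriv js f differentiable (at x)) \<and>
     (\<forall>js (k::nat). \<exists>C. \<forall>x. norm x ^ k * \<bar>iter_partial_deriv js f x\<bar> \<le> C)"

definition fourier :: "('a::euclidean_space \<Rightarrow> complex) \<Rightarrow> 'a \<Rightarrow> complex" where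
  "fourier f \<xi> = (LINT x|lborel. f x * exp (- 2 * of_real pi * \<i> * of_real (x \<bullet> \<xi>)))"

text \<open>The Fourier transform of a real even function is real, so that in this case
  \<open>real_fourier\<close> loses no information.\<close>

definition real_fourier :: "('a::euclidean_space \<Rightarrow> real) \<Rightarrow> 'a \<Rightarrow> real" where
  "real_fourier f \<xi> = Re (fourier (\<lambda>x. complex_of_real (f x)) \<xi>)"

lemma fourier_even_eq_real_fourier:
  fixes f :: "'a::euclidean_space \<Rightarrow> real"
  assumes [measurable]: "f \<in> borel_measurable borel" and even: "\<And>x. f (- x) = f x"
  shows "fourier (\<lambda>x. complex_of_real (f x)) \<xi> = complex_of_real (real_fourier f \<xi>)"
proof -
  let ?g = "\<lambda>x. complex_of_real (f x) * exp (- 2 * of_real pi * \<i> * of_real (x \<bullet> \<xi>))"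
  have lb: "distr lborel borel uminus = (lborel :: 'a measure)"
    by (subst lborel_affine[of "-1" 0]) (auto simp: density_1 one_ennreal_def[symmetric])
  have "cnj (fourier (\<lambda>x. complex_of_real (f x)) \<xi>) = (LINT x|lborel. cnj (?g x))"
    unfolding fourier_def by (rule Bochner_Integration.integral_cnj[symmetric])
  also have "\<dots> = (LINT x|lborel. ?g (- x))"
    by (simp add: even exp_cnj)
  also have "\<dots> = (LINT x|distr lborel borel uminus. ?g x)"
    by (rule integral_distr[symmetric]) measurable
  also have "\<dots> = fourier (\<lambda>x. complex_of_real (f x)) \<xi>"
    unfolding fourier_def lb ..
  finally show ?thesis
    unfolding real_fourier_def by (simp add: complex_eq_iff)
qed

end

theory Submission
  imports Defs "HOL-Real_Asymp.Real_Asymp" "HOL-Probability.Sinc_Integral"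
begin

text \<open>The hypotheses contradict each other. Let \<open>H\<close> be the function attached to the integer lattice.
  By Poisson summation, tightness of the bound forces \<open>H x = exp (- t * (norm x)\<^sup>2)\<close> and
  \<open>fourier H x = 0\<close> at all nonzero integer vectors, and, because \<open>H\<close> also serves all rotated copies of
  the lattice, at all \<open>x\<close> having the norm of a nonzero integer vector. Let \<open>w\<close> be \<open>1/2\<close> in eight
  coordinates and \<open>0\<close> in the others. Every vector of the integer lattice shifted by \<open>w\<close> has the norm of an
  integer vector, so Poisson summation for the translate of \<open>H\<close> by \<open>w\<close> and for the modulation of \<open>H\<close> by
  \<open>w\<close> gives \<open>fourier H 0 = theta2 t ^ 8 * theta3 t ^ (n - 8)\<close> and
  \<open>1 - H 0 = theta4 t ^ 8 * theta3 t ^ (n - 8)\<close>. Tightness then reads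
  \<open>theta2 t ^ 8 + theta4 t ^ 8 = theta3 t ^ 8\<close>, which is incompatible with Jacobi's identity
  \<open>theta3 t ^ 4 = theta2 t ^ 4 + theta4 t ^ 4\<close>, as \<open>theta2 t\<close> and \<open>theta4 t\<close> do not vanish.\<close>

section \<open>Theta functions\<close>

text \<open>The shift \<open>w\<close> must not create new norms. Four odd squares always add up to
  four times a sum of four integer squares, so half-odd coordinates may be introduced in blocks of
  four. A single block yields no contradiction: the same computation then ends in Jacobi's identity
  itself. Two blocks give its analogue with eighth powers, which fails because squaring Jacobi's
  identity leaves a positive cross term; this is why eight coordinates appear. On the Fourier side
  only signs at lattice points are given, and no decay of the transform is established. Poisson
  summation is therefore stated with Fejer means. They are finite sums with nonnegative weights, so
  the sign conditions bound each of them by its term at 0, while their convergence rests on the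
  decay of the function alone.\<close>

lemma has_sum_times_real:
  fixes f :: "'a \<Rightarrow> real" and g :: "'b \<Rightarrow> real"
  assumes "f summable_on UNIV" "g summable_on UNIV"
  shows "((\<lambda>(x, y). f x * g y) has_sum infsum f UNIV * infsum g UNIV) UNIV"
proof -
  have f: "(\<lambda>x. \<bar>f x\<bar>) summable_on UNIV" and g: "(\<lambda>x. \<bar>g x\<bar>) summable_on UNIV"
    using assms summable_on_iff_abs_summable_on_real[of f UNIV] summable_on_iff_abs_summable_on_real[of g UNIV]
    by auto
  have "(\<lambda>(x, y). \<bar>f x\<bar> * \<bar>g y\<bar>) summable_on Sigma UNIV (\<lambda>_. UNIV)"
  proof (rule summable_on_SigmaI)
    show "((\<lambda>y. case (x, y) of (x, y) \<Rightarrow> \<bar>f x\<bar> * \<bar>g y\<bar>) has_sum \<bar>f x\<bar> * infsum (\<lambda>y. \<bar>g y\<bar>) UNIV) UNIV" for x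
      using has_sum_cmult_right[OF has_sum_infsum[OF g]] by simp
    show "(\<lambda>x. \<bar>f x\<bar> * infsum (\<lambda>y. \<bar>g y\<bar>) UNIV) summable_on UNIV"
      by (rule summable_on_cmult_left[OF f])
  qed auto
  then have "(\<lambda>z. norm (case z of (x, y) \<Rightarrow> f x * g y)) summable_on UNIV \<times> UNIV"
    by (simp add: case_prod_unfold abs_mult)
  then have s: "(\<lambda>(x, y). f x * g y) summable_on UNIV \<times> UNIV"
    by (rule abs_summable_summable)
  have "infsum (\<lambda>(x, y). f x * g y) (UNIV \<times> UNIV) = infsum (\<lambda>x. infsum (\<lambda>y. f x * g y) UNIV) UNIV"
    by (rule infsum_Sigma'_banach[OF s, symmetric])
  also have "\<dots> = infsum f UNIV * infsum g UNIV"
    by (simp add: infsum_cmult_right' infsum_cmult_left')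
  finally show ?thesis
    using s by (metis UNIV_Times_UNIV has_sum_infsum)
qed

text \<open>Pairs of equal parity are \<open>(a + b, a - b)\<close>, pairs of different parity are
  \<open>(a + b + 1, a - b)\<close>.\<close>

lemma has_sum_parity_split:
  fixes f :: "int \<times> int \<Rightarrow> real"
  assumes even: "((\<lambda>(a, b). f (a + b, a - b)) has_sum s) UNIV"
    and odd: "((\<lambda>(a, b). f (a + b + 1, a - b)) has_sum s') UNIV"
  shows "(f has_sum (s + s')) UNIV"
proof -
  have "(f has_sum s) {(u, v). even (u + v)}"
    using even
    by (rule has_sum_reindex_bij_witness
        [of _ "\<lambda>(u, v). ((u + v) div 2, (u - v) div 2)" "\<lambda>(a, b). (a + b, a - b)", THEN iffD1, rotated -1])
       (auto elim!: evenE, presburger+)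
  moreover have "(f has_sum s') {(u, v). odd (u + v)}"
    using odd
    by (rule has_sum_reindex_bij_witness
        [of _ "\<lambda>(u, v). ((u + v - 1) div 2, (u - v - 1) div 2)" "\<lambda>(a, b). (a + b + 1, a - b)", THEN iffD1, rotated -1])
       (auto elim!: oddE, presburger+)
  moreover have "{(u, v). even (u + v)} \<union> {(u, v :: int). odd (u + v)} = UNIV"
    by auto
  ultimately show ?thesis
    using has_sum_Un_disjoint[of f "{(u, v). even (u + v)}" s "{(u, v). odd (u + v)}" s'] by fastforce
qed

section \<open>Convergence of one-dimensional Gaussian sums\<close>

lemma summable_on_inverse_1_plus_square_int: "(\<lambda>m::int. 1 / (1 + (of_int m)\<^sup>2 :: real)) summable_on UNIV"
proof -
  let ?f = "\<lambda>m::int. 1 / (1 + (of_int m)\<^sup>2 :: real)"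
  have "summable (\<lambda>n. norm (?f (int n)))"
  proof (rule summable_comparison_test')
    show "summable (\<lambda>n. inverse (real n ^ 2))"
      by (rule inverse_power_summable) simp
    show "norm (norm (?f (int n))) \<le> inverse (real n ^ 2)" if "n \<ge> 1" for n
      using that by (auto simp: inverse_eq_divide intro!: divide_left_mono mult_pos_pos add_pos_nonneg)
  qed
  then have *: "(?f \<circ> int) summable_on UNIV"
    by (auto simp: o_def intro: norm_summable_imp_summable_on)
  have "?f summable_on range int"
    using * by (subst summable_on_reindex) auto
  moreover have "?f summable_on range (\<lambda>n. - int n)"
    using * by (subst summable_on_reindex) (auto simp: o_def inj_on_def)
  ultimately have "?f summable_on range int \<union> range (\<lambda>n. - int n)"
    by (rule summable_on_union)
  moreover have "m \<in> range int \<union> range (\<lambda>n. - int n)" for m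
    by (cases m rule: int_cases2) auto
  then have "range int \<union> range (\<lambda>n. - int n) = UNIV"
    by blast
  ultimately show ?thesis by simp
qed

text \<open>Carries quadratic decay from the centre of a unit cell to all its points, whence the
  bound 1/2 on the shift. Gaussian sums, cubes and translates all use it.\<close>

lemma inverse_1_plus_square_shift:
  fixes x u :: real
  assumes "\<bar>u\<bar> \<le> 1 / 2"
  shows "1 / (1 + (x + u)\<^sup>2) \<le> 2 / (1 + x\<^sup>2)"
proof -
  have "u\<^sup>2 \<le> (1 / 2)\<^sup>2"
    using assms by (subst abs_le_square_iff[symmetric]) simp
  \<comment> \<open>The right side minus the left side is (x + 2 * u)^2.\<close>
  moreover have "x\<^sup>2 \<le> 2 * (x + u)\<^sup>2 + 2 * u\<^sup>2"
    using zero_le_power2[of "x + 2 * u"] by (simp add: power2_eq_square algebra_simps)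
  ultimately have "1 + x\<^sup>2 \<le> 2 * (1 + (x + u)\<^sup>2)"
    by (simp add: power2_eq_square)
  then show ?thesis
    by (simp add: field_simps add_pos_nonneg)
qed

text \<open>Weakening the exponential reduces all Gaussian sums to one summable majorant;
  \<open>max 1 (1 / t)\<close> treats small and large \<open>t\<close> together.\<close>

lemma exp_neg_le_inverse:
  fixes t y :: real
  assumes "0 < t" "0 \<le> y"
  shows "exp (- t * y) \<le> max 1 (1 / t) * (1 / (1 + y))"
proof -
  have "1 + t * y \<le> exp (t * y)"
    by (rule exp_ge_add_one_self)
  then have "exp (- t * y) \<le> 1 / (1 + t * y)"
    using assms by (simp add: exp_minus field_simps add_pos_nonneg)
  also have "1 + y \<le> max 1 (1 / t) * (1 + t * y)"
  proof -
    have "y = (1 / t) * (t * y)" using assms by simp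
    also have "\<dots> \<le> max 1 (1 / t) * (t * y)"
      using assms by (intro mult_right_mono) auto
    finally show ?thesis by (simp add: distrib_left)
  qed
  then have "1 / (1 + t * y) \<le> max 1 (1 / t) * (1 / (1 + y))"
    using assms by (simp add: field_simps add_pos_nonneg)
  finally show ?thesis .
qed

lemma summable_on_gaussian_int:
  fixes t u :: real
  assumes "0 < t" "\<bar>u\<bar> \<le> 1 / 2"
  shows "(\<lambda>m::int. exp (- t * (of_int m + u)\<^sup>2)) summable_on UNIV"
proof (rule summable_on_comparison_test)
  show "(\<lambda>m::int. max 1 (1 / t) * 2 * (1 / (1 + (of_int m)\<^sup>2))) summable_on UNIV"
    by (intro summable_on_cmult_right summable_on_inverse_1_plus_square_int)
  show "exp (- t * (of_int m + u)\<^sup>2) \<le> max 1 (1 / t) * 2 * (1 / (1 + (of_int m)\<^sup>2))" for m :: int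
  proof -
    have "exp (- t * (of_int m + u)\<^sup>2) \<le> max 1 (1 / t) * (1 / (1 + (of_int m + u)\<^sup>2))"
      by (rule exp_neg_le_inverse) (use assms in auto)
    also have "\<dots> \<le> max 1 (1 / t) * (2 / (1 + (of_int m)\<^sup>2))"
      by (intro mult_left_mono inverse_1_plus_square_shift assms) auto
    finally show ?thesis by simp
  qed
qed auto

section \<open>Theta constants and Jacobi's identity\<close>

text \<open>Jacobi's theta constants at the nome q = exp(-t), not exp(-pi * t): doubling
  \<open>t\<close> squares the nome, as in the duplication formulas below.\<close>

definition theta2 :: "real \<Rightarrow> real" where
  "theta2 t = (\<Sum>\<^sub>\<infinity>m::int. exp (- t * (of_int m + 1 / 2)\<^sup>2))"

definition theta3 :: "real \<Rightarrow> real" where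
  "theta3 t = (\<Sum>\<^sub>\<infinity>m::int. exp (- t * (of_int m)\<^sup>2))"

definition theta4 :: "real \<Rightarrow> real" where
  "theta4 t = (\<Sum>\<^sub>\<infinity>m::int. (if even m then 1 else - 1) * exp (- t * (of_int m)\<^sup>2))"

lemma summable_on_theta2: "0 < t \<Longrightarrow> (\<lambda>m::int. exp (- t * (of_int m + 1 / 2)\<^sup>2) :: real) summable_on UNIV"
  by (rule summable_on_gaussian_int) auto

lemma summable_on_theta3: "0 < t \<Longrightarrow> (\<lambda>m::int. exp (- t * (of_int m)\<^sup>2) :: real) summable_on UNIV"
  using summable_on_gaussian_int[of t 0] by simp

lemma summable_on_theta4:
  assumes "0 < t"
  shows "(\<lambda>m::int. (if even m then 1 else - 1) * exp (- t * (of_int m)\<^sup>2) :: real) summable_on UNIV"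
  by (rule abs_summable_summable, rule Infinite_Sum.abs_summable_on_comparison_test'[OF summable_on_theta3[OF assms]]) auto

text \<open>Rests on (a + b)^2 + (a - b)^2 = 2 * (a^2 + b^2) for pairs of equal parity and on (a + b
  + 1)^2 + (a - b)^2 = 2 * ((a + 1/2)^2 + (b + 1/2)^2) for the others.\<close>

lemma theta3_square: 
  assumes "0 < t"
  shows "(theta3 t)\<^sup>2 = (theta3 (2 * t))\<^sup>2 + (theta2 (2 * t))\<^sup>2"
proof -
  let ?f = "\<lambda>(u, v). exp (- t * (of_int u)\<^sup>2) * exp (- t * (of_int v)\<^sup>2)"
  have t2: "0 < 2 * t" using assms by simp
  have "(?f has_sum theta3 (2 * t) * theta3 (2 * t) + theta2 (2 * t) * theta2 (2 * t)) UNIV"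
  proof (rule has_sum_parity_split)
    show "((\<lambda>(a, b). ?f (a + b, a - b)) has_sum theta3 (2 * t) * theta3 (2 * t)) UNIV"
      using has_sum_times_real[OF summable_on_theta3[OF t2] summable_on_theta3[OF t2]]
      unfolding theta3_def
      by (rule has_sum_cong[THEN iffD1, rotated])
         (auto simp flip: exp_add simp: power2_eq_square algebra_simps)
    show "((\<lambda>(a, b). ?f (a + b + 1, a - b)) has_sum theta2 (2 * t) * theta2 (2 * t)) UNIV"
      using has_sum_times_real[OF summable_on_theta2[OF t2] summable_on_theta2[OF t2]]
      unfolding theta2_def
      by (rule has_sum_cong[THEN iffD1, rotated])
         (auto simp flip: exp_add simp: power2_eq_square algebra_simps)
  qed
  moreover have "(?f has_sum theta3 t * theta3 t) UNIV"
    unfolding theta3_def by (rule has_sum_times_real) (rule summable_on_theta3[OF assms])+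
  ultimately show ?thesis
    by (simp add: power2_eq_square has_sum_unique)
qed

text \<open>The sign attached to (u, v) depends only on the parity of u + v, so relative to
  \<open>theta3_square\<close> just the odd class changes sign.\<close>

lemma theta4_square: 
  assumes "0 < t"
  shows "(theta4 t)\<^sup>2 = (theta3 (2 * t))\<^sup>2 - (theta2 (2 * t))\<^sup>2"
proof -
  let ?s = "\<lambda>m::int. if even m then 1 else - 1 :: real"
  let ?f = "\<lambda>(u, v). (?s u * exp (- t * (of_int u)\<^sup>2)) * (?s v * exp (- t * (of_int v)\<^sup>2))"
  have t2: "0 < 2 * t" using assms by simp
  have "(?f has_sum theta3 (2 * t) * theta3 (2 * t) + - (theta2 (2 * t) * theta2 (2 * t))) UNIV"
  proof (rule has_sum_parity_split)
    show "((\<lambda>(a, b). ?f (a + b, a - b)) has_sum theta3 (2 * t) * theta3 (2 * t)) UNIV"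
      using has_sum_times_real[OF summable_on_theta3[OF t2] summable_on_theta3[OF t2]]
      unfolding theta3_def
      by (rule has_sum_cong[THEN iffD1, rotated])
         (auto simp flip: exp_add simp: power2_eq_square algebra_simps)
    show "((\<lambda>(a, b). ?f (a + b + 1, a - b)) has_sum - (theta2 (2 * t) * theta2 (2 * t))) UNIV"
      using has_sum_times_real[OF summable_on_theta2[OF t2] summable_on_theta2[OF t2], THEN has_sum_uminusI]
      unfolding theta2_def 
      by (rule has_sum_cong[THEN iffD1, rotated])
         (auto simp flip: exp_add simp: power2_eq_square algebra_simps)
  qed
  moreover have "(?f has_sum theta4 t * theta4 t) UNIV"
    unfolding theta4_def by (rule has_sum_times_real) (rule summable_on_theta4[OF assms])+
  ultimately show ?thesis
    by (simp add: power2_eq_square has_sum_unique)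
qed

lemma theta2_square: 
  assumes "0 < t"
  shows "(theta2 t)\<^sup>2 = 2 * theta3 (2 * t) * theta2 (2 * t)"
proof -
  let ?f = "\<lambda>(u, v). exp (- t * (of_int u + 1 / 2)\<^sup>2) * exp (- t * (of_int v + 1 / 2)\<^sup>2)"
  have t2: "0 < 2 * t" using assms by simp
  have "(?f has_sum theta2 (2 * t) * theta3 (2 * t) + theta3 (2 * t) * theta2 (2 * t)) UNIV"
  proof (rule has_sum_parity_split)
    show "((\<lambda>(a, b). ?f (a + b, a - b)) has_sum theta2 (2 * t) * theta3 (2 * t)) UNIV"
      using has_sum_times_real[OF summable_on_theta2[OF t2] summable_on_theta3[OF t2]]
      unfolding theta2_def theta3_def
      by (rule has_sum_cong[THEN iffD1, rotated])
         (auto simp flip: exp_add simp: power2_eq_square algebra_simps)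
    \<comment> \<open>On the odd class the exponent involves (a + 1)^2 and (b + 1/2)^2; the shift of
      \<open>a\<close> is removed by reindexing.\<close>
    have "((\<lambda>(a, b). exp (- (2 * t) * (of_int a)\<^sup>2) * exp (- (2 * t) * (of_int b + 1 / 2)\<^sup>2))
             has_sum theta3 (2 * t) * theta2 (2 * t)) UNIV"
      unfolding theta2_def theta3_def
      by (rule has_sum_times_real) (rule summable_on_theta2[OF t2] summable_on_theta3[OF t2])+
    then show "((\<lambda>(a, b). ?f (a + b + 1, a - b)) has_sum theta3 (2 * t) * theta2 (2 * t)) UNIV"
      by (rule has_sum_reindex_bij_witness[of _ "\<lambda>(a, b). (a + 1, b)" "\<lambda>(a, b). (a - 1, b)", THEN iffD1, rotated -1])
         (auto simp flip: exp_add simp: power2_eq_square algebra_simps)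
  qed
  moreover have "(?f has_sum theta2 t * theta2 t) UNIV"
    unfolding theta2_def by (rule has_sum_times_real) (rule summable_on_theta2[OF assms])+
  ultimately have "theta2 (2 * t) * theta3 (2 * t) + theta3 (2 * t) * theta2 (2 * t) = theta2 t * theta2 t"
    by (rule has_sum_unique)
  then show ?thesis
    by (simp add: power2_eq_square mult_ac)
qed

text \<open>With A = theta3 (2 * t)^2 and B = theta2 (2 * t)^2 the three duplication formulas reduce
  it to (A + B)^2 = 4 * A * B + (A - B)^2.\<close>

lemma jacobi_theta_identity:
  assumes "0 < t"
  shows "theta3 t ^ 4 = theta2 t ^ 4 + theta4 t ^ 4"
proof -
  have e: "x ^ 4 = (x\<^sup>2)\<^sup>2" for x :: real
    by simp
  show ?thesis
    unfolding e theta3_square[OF assms] theta4_square[OF assms] theta2_square[OF assms]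
    by (simp add: power2_eq_square algebra_simps)
qed

section \<open>Nonvanishing of theta4 and the strict inequality\<close>

text \<open>A zero at \<open>t\<close> makes theta2 and theta3 agree in square at 2 * t, and
  Jacobi's identity there leaves nothing for theta4.\<close>

lemma theta4_double_eq_0:
  assumes "0 < t" "theta4 t = 0"
  shows "theta4 (2 * t) = 0"
proof -
  have "theta2 (2 * t) ^ 4 = ((theta2 (2 * t))\<^sup>2)\<^sup>2"
    by simp
  also have "(theta2 (2 * t))\<^sup>2 = (theta3 (2 * t))\<^sup>2"
    using theta4_square[OF assms(1)] assms(2) by simp
  finally show ?thesis
    using jacobi_theta_identity[of "2 * t"] assms(1) by simp
qed

lemma theta4_tendsto_1_bound:
  assumes "1 \<le> s"
  shows "\<bar>theta4 s - 1\<bar> \<le> exp (1 - s) * theta3 1"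
proof -
  let ?s = "\<lambda>m::int. if even m then 1 else - 1 :: real"
  have "((\<lambda>m::int. if m = 0 then 1 else 0 :: real) has_sum 1) {0}"
    by (rule has_sum_finiteI) auto
  then have "((\<lambda>m::int. if m = 0 then 1 else 0 :: real) has_sum 1) UNIV"
    by (rule has_sum_cong_neutral[THEN iffD1, rotated -1]) auto
  moreover have "((\<lambda>m. ?s m * exp (- s * (of_int m)\<^sup>2)) has_sum theta4 s) UNIV"
    unfolding theta4_def using summable_on_theta4[of s] assms by (intro has_sum_infsum) simp
  ultimately have "((\<lambda>m. ?s m * exp (- s * (of_int m)\<^sup>2) - (if m = 0 then 1 else 0)) has_sum theta4 s - 1) UNIV"
    unfolding diff_conv_add_uminus by (intro has_sum_add has_sum_uminusI)
  moreover have "((\<lambda>m. exp (1 - s) * exp (- 1 * (of_int m)\<^sup>2)) has_sum exp (1 - s) * theta3 1) UNIV"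
    unfolding theta3_def by (intro has_sum_cmult_right has_sum_infsum summable_on_theta3) simp
  moreover have "norm (?s m * exp (- s * (of_int m)\<^sup>2) - (if m = 0 then 1 else 0))
      \<le> exp (1 - s) * exp (- 1 * (of_int m)\<^sup>2)" for m :: int
  proof (cases "m = 0")
    case False
    then have "1 \<le> m\<^sup>2"
      by (simp add: int_one_le_iff_zero_less)
    then have "(1::real) \<le> (of_int m)\<^sup>2"
      by (metis of_int_1_le_iff of_int_power)
    \<comment> \<open>Equivalent to - s * m^2 \<le> (1 - s) - m^2: the factor exp (1 - s) splits off
      and a fixed convergent sum remains.\<close>
    then have "(s - 1) * 1 \<le> (s - 1) * (of_int m)\<^sup>2"
      using assms by (intro mult_left_mono) auto
    then show ?thesis
      using False by (auto simp flip: exp_add simp: abs_mult algebra_simps)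
  qed simp
  ultimately have "theta4 s - 1 \<le> exp (1 - s) * theta3 1" "- (theta4 s - 1) \<le> exp (1 - s) * theta3 1"
    unfolding real_norm_def abs_le_iff by (blast intro: has_sum_mono has_sum_uminusI)+
  then show ?thesis
    by simp
qed

text \<open>A zero of \<open>theta4\<close> would propagate to \<open>2 ^ k * t\<close>, but \<open>theta4\<close> tends to 1 at infinity.\<close>

lemma theta4_nonzero:
  assumes "0 < t"
  shows "theta4 t \<noteq> 0"
proof
  assume z: "theta4 t = 0"
  have zk: "theta4 (2 ^ k * t) = 0" for k
  proof (induction k)
    case (Suc k)
    then show ?case
      using theta4_double_eq_0[of "2 ^ k * t"] assms by (simp add: mult.assoc)
  qed (use z in simp)
  have "((\<lambda>s. exp (1 - s) * theta3 1) \<longlongrightarrow> 0) at_top"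
    by real_asymp
  then have "eventually (\<lambda>s. exp (1 - s) * theta3 1 < 1) at_top"
    by (rule order_tendstoD) simp
  then have "eventually (\<lambda>s. exp (1 - s) * theta3 1 < 1 \<and> 1 \<le> s) at_top"
    using eventually_ge_at_top by (rule eventually_conj)
  moreover have "filterlim (\<lambda>k::nat. 2 ^ k * t) at_top sequentially"
    using assms by real_asymp
  ultimately have "eventually (\<lambda>k::nat. exp (1 - 2 ^ k * t) * theta3 1 < 1 \<and> 1 \<le> 2 ^ k * t) sequentially"
    by (auto simp: filterlim_iff)
  then obtain k where "exp (1 - 2 ^ k * t) * theta3 1 < 1" "1 \<le> 2 ^ k * t"
    by (auto simp: eventually_sequentially)
  then show False
    using theta4_tendsto_1_bound[of "2 ^ k * t"] zk[of k] by simp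
qed

lemma theta2_pos:
  assumes "0 < t"
  shows "0 < theta2 t"
proof -
  have "exp (- t * (1 / 2)\<^sup>2) = (\<Sum>\<^sub>\<infinity>m\<in>{0::int}. exp (- t * (of_int m + 1 / 2)\<^sup>2))"
    by simp
  also have "\<dots> \<le> theta2 t"
    unfolding theta2_def by (rule infsum_mono_neutral) (use summable_on_theta2[OF assms] in auto)
  finally show ?thesis
    by (rule less_le_trans[rotated]) simp
qed

lemma theta3_pos:
  assumes "0 < t"
  shows "0 < theta3 t"
proof -
  have "1 = (\<Sum>\<^sub>\<infinity>m\<in>{0::int}. exp (- t * (of_int m)\<^sup>2))"
    by simp
  also have "\<dots> \<le> theta3 t"
    unfolding theta3_def by (rule infsum_mono_neutral) (use summable_on_theta3[OF assms] in auto)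
  finally show ?thesis by simp
qed

text \<open>Squaring Jacobi's identity leaves the cross term 2 * theta2^4 * theta4^4, which is
  positive since neither factor vanishes.\<close>

lemma theta_power8_less:
  assumes "0 < t"
  shows "theta2 t ^ 8 + theta4 t ^ 8 < theta3 t ^ 8"
proof -
  have e: "x ^ 8 = (x ^ 4)\<^sup>2" for x :: real
    by simp
  have "0 < theta2 t ^ 4 * theta4 t ^ 4"
    using theta2_pos[OF assms] theta4_nonzero[OF assms] by simp
  then show ?thesis
    unfolding e jacobi_theta_identity[OF assms] by (simp add: power2_sum)
qed

section \<open>Orthogonal transformations, Gram determinants and norms of half-odd vectors\<close>

lemma lborel_translation_nn_integral:
  fixes c :: "'a::euclidean_space"
  assumes [measurable]: "f \<in> borel_measurable borel"
  shows "(\<integral>\<^sup>+x. f (c + x) \<partial>lborel) = (\<integral>\<^sup>+x. f x \<partial>lborel)"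
proof -
  have "(\<integral>\<^sup>+x. f x \<partial>lborel) = (\<integral>\<^sup>+x. f x \<partial>distr lborel borel ((+) c))"
    by (simp add: lborel_distr_plus)
  also have "\<dots> = (\<integral>\<^sup>+x. f (c + x) \<partial>lborel)"
    by (subst nn_integral_distr) auto
  finally show ?thesis ..
qed

lemma lborel_reflection_nn_integral:
  fixes c :: "'a::euclidean_space"
  assumes [measurable]: "f \<in> borel_measurable borel"
  shows "(\<integral>\<^sup>+x. f (c - x) \<partial>lborel) = (\<integral>\<^sup>+x. f x \<partial>lborel)"
proof -
  have "distr lborel borel uminus = (lborel :: 'a measure)"
    by (subst lborel_affine[of "- 1" 0]) (auto simp: density_1 one_ennreal_def[symmetric])
  then have "(\<integral>\<^sup>+x. f (c + x) \<partial>lborel) = (\<integral>\<^sup>+x. f (c + x) \<partial>distr lborel borel uminus)"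
    by simp
  also have "\<dots> = (\<integral>\<^sup>+x. f (c - x) \<partial>lborel)"
    by (subst nn_integral_distr) auto
  finally show ?thesis
    by (simp add: lborel_translation_nn_integral)
qed

text \<open>The image measure of \<open>lborel\<close> under \<open>U\<close> is translation invariant, hence a multiple of
  \<open>lborel\<close> by evaluating \<open>\<integral>\<integral> 1\<^sub>A(U x) 1\<^sub>B(U x + y) dx dy\<close> in both orders; taking for \<open>B\<close> the
  unit ball shows that the factor is 1.\<close>

lemma distr_lborel_orthogonal_transformation:
  fixes U :: "'a::euclidean_space \<Rightarrow> 'a"
  assumes U: "orthogonal_transformation U"
  shows "distr lborel borel U = lborel"
proof (rule measure_eqI)
  have lin: "linear U"
    using U by (simp add: orthogonal_transformation_linear)
  have [measurable]: "U \<in> borel_measurable borel"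
    by (intro borel_measurable_continuous_onI linear_continuous_on) (use lin linear_linear in blast)
  fix A :: "'a set" assume "A \<in> sets (distr lborel borel U)"
  then have A[measurable]: "A \<in> sets borel"
    by simp
  define B :: "'a set" where "B = ball 0 1"
  have B[measurable]: "B \<in> sets borel"
    by (simp add: B_def)
  define a b :: "'a \<Rightarrow> ennreal" where "a = indicator A" and "b = indicator B"
  have [measurable]: "a \<in> borel_measurable borel" "b \<in> borel_measurable borel"
    by (simp_all add: a_def b_def)
  have bU: "b (U x) = b x" for x
    using U by (simp add: b_def B_def indicator_def orthogonal_transformation_norm)
  have "surj U"
    using U by (rule orthogonal_transformation_surj)
  then obtain V where V: "U (V y) = y" for y
    by (metis surj_f_inv_f)
  have "(\<integral>\<^sup>+x. a (U x) \<partial>lborel) * (\<integral>\<^sup>+y. b y \<partial>lborel)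
      = (\<integral>\<^sup>+x. (\<integral>\<^sup>+y. a (U x) * b (U x + y) \<partial>lborel) \<partial>lborel)"
    by (simp add: nn_integral_cmult lborel_translation_nn_integral nn_integral_multc)
  also have "\<dots> = (\<integral>\<^sup>+y. (\<integral>\<^sup>+x. a (U x) * b (U x + y) \<partial>lborel) \<partial>lborel)"
    by (rule lborel_pair.Fubini') measurable
  also have "\<dots> = (\<integral>\<^sup>+y. (\<integral>\<^sup>+x. a (U x - y) * b (U x) \<partial>lborel) \<partial>lborel)"
  proof (rule nn_integral_cong)
    \<comment> \<open>As U (V y) = y, translating x by - V y moves the shift from the argument of
      \<open>b\<close> to that of \<open>a\<close>.\<close>
    fix y
    have "(\<integral>\<^sup>+x. a (U x) * b (U x + y) \<partial>lborel) = (\<integral>\<^sup>+x. a (U (- V y + x)) * b (U (- V y + x) + y) \<partial>lborel)"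
      by (rule lborel_translation_nn_integral[symmetric]) measurable
    also have "\<dots> = (\<integral>\<^sup>+x. a (U x - y) * b (U x) \<partial>lborel)"
      by (simp add: linear_add[OF lin] linear_diff[OF lin] linear_neg[OF lin] V)
    finally show "(\<integral>\<^sup>+x. a (U x) * b (U x + y) \<partial>lborel) = (\<integral>\<^sup>+x. a (U x - y) * b (U x) \<partial>lborel)" .
  qed
  also have "\<dots> = (\<integral>\<^sup>+x. (\<integral>\<^sup>+y. a (U x - y) * b (U x) \<partial>lborel) \<partial>lborel)"
    by (rule lborel_pair.Fubini'[symmetric]) measurable
  also have "\<dots> = (\<integral>\<^sup>+y. a y \<partial>lborel) * (\<integral>\<^sup>+x. b x \<partial>lborel)"
    by (simp add: nn_integral_cmult nn_integral_multc lborel_reflection_nn_integral bU)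
  finally have eq: "(\<integral>\<^sup>+x. a (U x) \<partial>lborel) * emeasure lborel B = emeasure lborel A * emeasure lborel B"
    by (simp add: a_def b_def)
  have "emeasure lborel B \<noteq> 0" "emeasure lborel B \<noteq> \<infinity>"
    using less_imp_neq[OF unit_ball_vol_pos[of "real DIM('a)"], symmetric]
    by (simp_all add: B_def emeasure_ball)
  then have "(\<integral>\<^sup>+x. a (U x) \<partial>lborel) = emeasure lborel A"
    using eq by (metis ennreal_mult_cancel_left mult.commute infinity_ennreal_def)
  moreover have "emeasure (distr lborel borel U) A = (\<integral>\<^sup>+x. a x \<partial>distr lborel borel U)"
    by (simp add: a_def)
  ultimately show "emeasure (distr lborel borel U) A = emeasure lborel A"
    by (simp add: nn_integral_distr)
qed simp

text \<open>An orthogonal map preserves both the measure and the pairing. This turns statements on a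
  transform at rotated integer vectors into statements at integer vectors.\<close>

lemma fourier_orthogonal_transformation:
  fixes U :: "'a::euclidean_space \<Rightarrow> 'a" and f :: "'a \<Rightarrow> complex"
  assumes U: "orthogonal_transformation U" and [measurable]: "f \<in> borel_measurable borel"
  shows "fourier (\<lambda>x. f (U x)) \<xi> = fourier f (U \<xi>)"
proof -
  have [measurable]: "U \<in> borel_measurable borel"
    by (intro borel_measurable_continuous_onI linear_continuous_on)
       (use U orthogonal_transformation_linear linear_linear in blast)
  have "fourier f (U \<xi>) = (LINT x|distr lborel borel U. f x * exp (- 2 * of_real pi * \<i> * of_real (x \<bullet> U \<xi>)))"
    by (simp add: fourier_def distr_lborel_orthogonal_transformation[OF U])
  also have "\<dots> = (LINT x|lborel. f (U x) * exp (- 2 * of_real pi * \<i> * of_real (U x \<bullet> U \<xi>)))"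
    by (subst integral_distr) auto
  finally show ?thesis
    using U by (simp add: fourier_def orthogonal_transformation_def)
qed

lemma fourier_translation:
  fixes f :: "'a::euclidean_space \<Rightarrow> complex"
  assumes [measurable]: "f \<in> borel_measurable borel"
  shows "fourier (\<lambda>x. f (x + w)) \<xi> = exp (2 * of_real pi * \<i> * of_real (w \<bullet> \<xi>)) * fourier f \<xi>"
proof -
  have "fourier f \<xi> = (LINT x|distr lborel borel ((+) w). f x * exp (- 2 * of_real pi * \<i> * of_real (x \<bullet> \<xi>)))"
    by (simp add: fourier_def lborel_distr_plus)
  also have "\<dots> = (LINT x|lborel. f (w + x) * exp (- 2 * of_real pi * \<i> * of_real ((w + x) \<bullet> \<xi>)))"
    by (subst integral_distr) auto
  also have "\<dots> = (LINT x|lborel. exp (- 2 * of_real pi * \<i> * of_real (w \<bullet> \<xi>)) *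
      (f (x + w) * exp (- 2 * of_real pi * \<i> * of_real (x \<bullet> \<xi>))))"
    by (intro Bochner_Integration.integral_cong)
       (auto simp: inner_add_left exp_add[symmetric] algebra_simps)
  also have "\<dots> = exp (- 2 * of_real pi * \<i> * of_real (w \<bullet> \<xi>)) * fourier (\<lambda>x. f (x + w)) \<xi>"
    by (simp add: fourier_def)
  finally show ?thesis
    by (simp flip: exp_add mult.assoc)
qed

section \<open>Integral Gram matrices and stability of rotated integer lattices\<close>

text \<open>A homotopy argument: G s = (1 - s) * identity + s * Gram matrix is positive definite,
  hence nonsingular, for all s in [0, 1]. Its determinant is continuous and equals 1 at s = 0, so it
  cannot reach a value \<le> 0 at s = 1.\<close>

lemma det_gram_pos:
  fixes vs :: "'a::real_inner list"
  assumes d: "distinct vs" and ind: "independent (set vs)"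
  shows "0 < Determinant.det (gram vs)"
proof -
  define n where "n = length vs"
  define G where "G s = mat n n (\<lambda>(i, j). (1 - s) * (if i = j then 1 else 0) + s * (vs ! i \<bullet> vs ! j))" for s :: real
  have Gc: "G s \<in> carrier_mat n n" for s
    by (simp add: G_def)
  have nz: "Determinant.det (G s) \<noteq> 0" if s: "0 \<le> s" "s \<le> 1" for s
  proof
    assume "Determinant.det (G s) = 0"
    then obtain v where v: "v \<in> carrier_vec n" "v \<noteq> 0\<^sub>v n" "G s *\<^sub>v v = 0\<^sub>v n"
      using det_0_iff_vec_prod_zero[OF Gc] by auto
    define c where "c = (\<lambda>i. vec_index v i)"
    have row: "(1 - s) * c i + s * (\<Sum>j<n. (vs ! i \<bullet> vs ! j) * c j) = 0" if "i < n" for i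
    proof -
      have "vec_index (G s *\<^sub>v v) i = 0"
        using v(3) that by simp
      then have "(\<Sum>j<n. ((1 - s) * (if i = j then 1 else 0) + s * (vs ! i \<bullet> vs ! j)) * c j) = 0"
        using that v(1) by (simp add: G_def scalar_prod_def atLeast0LessThan c_def)
      moreover have "((1 - s) * (if i = j then 1 else 0) + s * (vs ! i \<bullet> vs ! j)) * c j
          = (if i = j then (1 - s) * c j else 0) + s * ((vs ! i \<bullet> vs ! j) * c j)" for j
        by (simp add: algebra_simps)
      ultimately show ?thesis
        using that by (simp add: sum.distrib sum_distrib_left[symmetric])
    qed
    \<comment> \<open>Pairing the kernel equation with \<open>c\<close> gives the quadratic form of
      G s, a sum of two nonnegative terms.\<close>
    have "0 = (\<Sum>i<n. c i * ((1 - s) * c i + s * (\<Sum>j<n. (vs ! i \<bullet> vs ! j) * c j)))"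
      using row by simp
    also have "\<dots> = (1 - s) * (\<Sum>i<n. (c i)\<^sup>2) + s * (\<Sum>i<n. \<Sum>j<n. c i * ((vs ! i \<bullet> vs ! j) * c j))"
      by (simp add: sum.distrib sum_subtractf sum_distrib_left algebra_simps power2_eq_square)
    also have "(\<Sum>i<n. \<Sum>j<n. c i * ((vs ! i \<bullet> vs ! j) * c j)) = (norm (\<Sum>i<n. c i *\<^sub>R vs ! i))\<^sup>2"
      unfolding power2_norm_eq_inner inner_sum_left by (simp add: inner_sum_right mult_ac sum_distrib_left)
    finally have "(1 - s) * (\<Sum>i<n. (c i)\<^sup>2) + s * (norm (\<Sum>i<n. c i *\<^sub>R vs ! i))\<^sup>2 = 0" ..
    then have z: "(1 - s) * (\<Sum>i<n. (c i)\<^sup>2) = 0" "s * (norm (\<Sum>i<n. c i *\<^sub>R vs ! i))\<^sup>2 = 0"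
      using s by (smt (verit) mult_nonneg_nonneg sum_nonneg zero_le_power2)+
    \<comment> \<open>For s < 1 the identity part alone forces c = 0; linear independence enters at
      s = 1.\<close>
    have "c i = 0" if "i < n" for i
    proof (cases "s = 1")
      case True
      with z have "(\<Sum>i<length vs. c i *\<^sub>R vs ! i) = 0"
        by (simp add: n_def)
      then show ?thesis
        using independent_list_coeffs[OF d ind, of c i] that n_def by simp
    next
      case False
      with z have "(\<Sum>i<n. (c i)\<^sup>2) = 0" by simp
      then show ?thesis
        using that by (simp add: sum_nonneg_eq_0_iff)
    qed
    then show False
      using v(1,2) by (auto simp: c_def intro: eq_vecI)
  qed
  have detG: "Determinant.det (G s) = (\<Sum>p | p permutes {0..<n}. signof p *
      (\<Prod>i = 0..<n. (1 - s) * (if i = p i then 1 else 0) + s * (vs ! i \<bullet> vs ! p i)))" for s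
    unfolding Determinant.det_def'[OF Gc]
    by (intro sum.cong prod.cong arg_cong2[of _ _ _ _ times] refl) (auto simp: G_def dest: permutes_in_image)
  have cont: "continuous_on {0..1} (\<lambda>s. Determinant.det (G s))"
    unfolding detG by (intro continuous_intros)
  have G0: "Determinant.det (G 0) = 1"
  proof -
    have "G 0 = 1\<^sub>m n" by (auto simp: G_def)
    then show ?thesis by simp
  qed
  have G1: "G 1 = gram vs"
    by (auto simp: G_def gram_def n_def)
  show ?thesis
  proof (rule ccontr)
    assume "\<not> ?thesis"
    then have "\<exists>s\<ge>0. s \<le> 1 \<and> Determinant.det (G s) = 0"
      by (intro IVT2') (use cont G0 G1 in auto)
    then show False using nz by auto
  qed
qed

text \<open>The Gram determinant is an integer and positive, hence at least 1. Integrality passes to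
  sublattices, so this settles the condition on all of them at once.\<close>

lemma covolume_ge_1_if_integral:
  fixes M :: "'a::real_inner set"
  assumes "is_lattice M" "\<And>x y. x \<in> M \<Longrightarrow> y \<in> M \<Longrightarrow> x \<bullet> y \<in> \<int>"
  shows "1 \<le> covolume M"
proof -
  obtain vs where vs: "lattice_basis vs M"
    using assms(1) by (auto simp: is_lattice_def)
  have "\<forall>i<length vs. \<forall>j<length vs. \<exists>k::int. vs ! i \<bullet> vs ! j = of_int k"
    using assms(2) lattice_basis_mem[OF vs] by (meson Ints_cases)
  then obtain k :: "nat \<Rightarrow> nat \<Rightarrow> int"
    where k: "\<And>i j. i < length vs \<Longrightarrow> j < length vs \<Longrightarrow> vs ! i \<bullet> vs ! j = of_int (k i j)"
    by metis
  define K where "K = mat (length vs) (length vs) (\<lambda>(i, j). k i j)"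
  have "gram vs = map_mat of_int K"
    using k by (auto simp: gram_def K_def)
  then have det: "Determinant.det (gram vs) = of_int (Determinant.det K)"
    by simp
  moreover have "0 < Determinant.det (gram vs)"
    using vs by (intro det_gram_pos) (auto simp: lattice_basis_def)
  ultimately have "1 \<le> Determinant.det (gram vs)"
    by simp
  then show ?thesis
    by (simp add: covolume_eq[OF vs])
qed

lemma inner_int_lattice:
  fixes x y :: "real^'n"
  assumes "x \<in> int_lattice" "y \<in> int_lattice"
  shows "x \<bullet> y \<in> \<int>"
  using assms by (auto simp: int_lattice_def inner_vec_def intro!: Ints_sum)

text \<open>The rotated axis vectors are orthonormal, so their Gram matrix is the identity, and all
  inner products in the lattice are integers.\<close>

lemma stable_orthogonal_image_int_lattice:
  fixes U :: "real^'n \<Rightarrow> real^'n"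
  assumes U: "orthogonal_transformation U"
  shows "stable (U ` (int_lattice :: (real^'n) set))"
proof -
  define L where "L = U ` (int_lattice :: (real^'n) set)"
  have lin: "linear U" and inj: "inj U"
    using U orthogonal_transformation_linear orthogonal_transformation_inj by blast+
  \<comment> \<open>A lattice basis is a list, so the coordinates are enumerated;
    \<open>the_inv_into\<close> returns the position of a coordinate in the enumeration.\<close>
  obtain idx :: "'n list" where idx: "set idx = UNIV" "distinct idx"
    using finite_distinct_list[of "UNIV :: 'n set"] by auto
  define n where "n = length idx"
  have bij: "bij_betw ((!) idx) {..<n} UNIV"
    using bij_betw_nth[OF idx(2), of "{..<n}" UNIV] idx(1) by (simp add: n_def)
  define vs where "vs = map (\<lambda>i. U (axis i 1)) idx"
  have len: "length vs = n"
    by (simp add: vs_def n_def)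
  have set: "set vs = U ` Basis"
    using idx(1) by (auto simp: vs_def Basis_vec_def)
  have dist: "distinct vs"
    unfolding vs_def distinct_map
    using idx inj by (auto intro!: inj_onI dest!: injD[OF inj] simp: axis_eq_axis)
  have ind: "independent (set vs)"
    unfolding set
    by (rule linear_independent_injective_image[OF lin independent_Basis]) (use inj in \<open>auto intro: inj_on_subset\<close>)
  have span: "span (set vs) = UNIV"
    unfolding set using lin orthogonal_transformation_surj[OF U] by (simp add: linear_span_image)
  have nth: "vs ! i = U (axis (idx ! i) 1)" if "i < n" for i
    using that by (simp add: vs_def n_def)
  have comb: "(\<Sum>i<length vs. of_int (c i) *\<^sub>R vs ! i)
      = U (\<chi> j. of_int (c (the_inv_into {..<n} ((!) idx) j)))" for c :: "nat \<Rightarrow> int"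
  proof -
    let ?g = "the_inv_into {..<n} ((!) idx)"
    have g: "?g (idx ! i) = i" if "i < n" for i
      using that bij by (auto simp: bij_betw_def the_inv_into_f_f)
    have "(\<Sum>i<length vs. of_int (c i) *\<^sub>R vs ! i) = U (\<Sum>i<n. of_int (c i) *\<^sub>R axis (idx ! i) 1)"
      by (simp add: len nth linear_sum[OF lin] linear_scale[OF lin])
    also have "(\<Sum>i<n. of_int (c i) *\<^sub>R axis (idx ! i) 1) = (\<Sum>i<n. of_int (c (?g (idx ! i))) *\<^sub>R axis (idx ! i) 1)"
      by (simp add: g)
    also have "\<dots> = (\<Sum>j\<in>UNIV. of_int (c (?g j)) *\<^sub>R axis j (1::real))"
      by (rule sum.reindex_bij_betw[OF bij])
    also have "\<dots> = (\<chi> j. of_int (c (?g j)))"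
      by (simp add: Finite_Cartesian_Product.vec_eq_iff axis_def if_distrib cong: if_cong)
    finally show ?thesis .
  qed
  have basis: "lattice_basis vs L"
    unfolding lattice_basis_def
  proof (intro conjI dist ind)
    show "L = int_combs vs"
    proof (intro Set.set_eqI iffI)
      fix x assume "x \<in> L"
      then obtain y where y: "x = U y" "\<forall>i. y $ i \<in> \<int>"
        by (auto simp: L_def int_lattice_def)
      from y(2) have "\<forall>i. \<exists>m::int. y $ i = of_int m"
        by (auto elim: Ints_cases)
      then obtain k :: "'n \<Rightarrow> int" where k: "\<And>i. y $ i = of_int (k i)"
        by metis
      have "idx ! the_inv_into {..<n} ((!) idx) j = j" for j
        using bij by (intro f_the_inv_into_f) (auto simp: bij_betw_def)
      then have "x = (\<Sum>i<length vs. of_int (k (idx ! i)) *\<^sub>R vs ! i)"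
        unfolding comb y(1) by (intro arg_cong[of _ _ U]) (simp add: k Finite_Cartesian_Product.vec_eq_iff)
      then show "x \<in> int_combs vs"
        unfolding int_combs_def by (intro CollectI exI[of _ "\<lambda>i. k (idx ! i)"]) simp
    qed (auto simp: int_combs_def comb L_def int_lattice_def)
  qed
  have "gram vs = 1\<^sub>m n"
  proof (rule eq_matI)
    fix i j assume ij: "i < dim_row (1\<^sub>m n)" "j < dim_col (1\<^sub>m n)"
    then have "gram vs $$ (i, j) = axis (idx ! i) 1 \<bullet> axis (idx ! j) (1::real)"
      using U by (simp add: gram_def len nth orthogonal_transformation_def)
    also have "\<dots> = 1\<^sub>m n $$ (i, j)"
      using ij idx(2) by (auto simp: inner_axis_axis nth_eq_iff_index_eq n_def)
    finally show "gram vs $$ (i, j) = 1\<^sub>m n $$ (i, j)" .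
  qed (simp_all add: gram_def len)
  then have "covolume L = 1"
    by (simp add: covolume_eq[OF basis])
  moreover have "full_rank_lattice L"
    using basis span by (auto simp: full_rank_lattice_def)
  moreover have "x \<bullet> y \<in> \<int>" if "x \<in> L" "y \<in> L" for x y :: "real^'n"
    using that U by (auto simp: L_def orthogonal_transformation_def inner_int_lattice)
  ultimately show ?thesis
    unfolding stable_def L_def[symmetric] by (auto intro!: covolume_ge_1_if_integral)
qed

text \<open>Makes the sign condition (c) available at the images of integer vectors.\<close>

lemma orthogonal_image_int_lattice_subset_dual:
  fixes U :: "real^'n \<Rightarrow> real^'n"
  assumes U: "orthogonal_transformation U"
  shows "U ` (int_lattice :: (real^'n) set) \<subseteq> dual_lattice (U ` int_lattice)"
  using U by (auto simp: dual_lattice_def orthogonal_transformation_def inner_int_lattice)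

text \<open>Up to a sign change in one coordinate, the Hadamard matrix of order 4, divided by 2, maps
  half-odd vectors to integral ones.\<close>

lemma odd_four_squares:
  fixes a b c d :: int
  assumes "odd a" "odd b" "odd c" "odd d"
  shows "\<exists>p q r s::int. 4 * (p\<^sup>2 + q\<^sup>2 + r\<^sup>2 + s\<^sup>2) = a\<^sup>2 + b\<^sup>2 + c\<^sup>2 + d\<^sup>2"
proof -
  have main: "\<exists>p q r s::int. 4 * (p\<^sup>2 + q\<^sup>2 + r\<^sup>2 + s\<^sup>2) = a\<^sup>2 + b\<^sup>2 + c\<^sup>2 + e\<^sup>2"
    if e: "4 dvd a + b + c + e" "odd e" for e
  proof -
    obtain k where "a + b + c + e = 4 * k"
      using e(1) unfolding dvd_def by blast
    then have k: "e = 4 * k - a - b - c"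
      by simp
    obtain a' b' c' where o: "a = 2 * a' + 1" "b = 2 * b' + 1" "c = 2 * c' + 1"
      using assms by (auto elim!: oddE)
    show ?thesis
      \<comment> \<open>The witnesses are (a + b + c + e) / 4, (a + b - c - e) / 4, (a - b + c - e)
        / 4 and (- a + b + c - e) / 4, rewritten by e = 4 * k - a - b - c.\<close>
      by (rule exI[of _ k], rule exI[of _ "a' + b' + 1 - k"], rule exI[of _ "a' + c' + 1 - k"],
          rule exI[of _ "b' + c' + 1 - k"])
         (simp add: k o power2_eq_square algebra_simps)
  qed
  \<comment> \<open>Both sums are even and they differ by 2 * d, which is 2 modulo 4.\<close>
  have "4 dvd a + b + c + d \<or> 4 dvd a + b + c + - d"
  proof -
    obtain m d' where m: "a + b + c = 2 * m + 1" and d': "d = 2 * d' + 1"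
      using assms by (metis odd_add oddE)
    have "a + b + c + d = 2 * (m + d' + 1)" "a + b + c + - d = 2 * (m - d')"
      using m d' by auto
    moreover have "even (m + d' + 1) \<or> even (m - d')"
      by auto
    moreover have "4 dvd 2 * k \<longleftrightarrow> even k" for k :: int
      by presburger
    ultimately show ?thesis
      by metis
  qed
  then show ?thesis
    using main[of d] main[of "- d"] assms(4) by auto
qed

lemma odd_squares_card_4:
  fixes x :: "'a \<Rightarrow> int"
  assumes "card S = 4" "\<And>i. i \<in> S \<Longrightarrow> odd (x i)"
  shows "\<exists>y::'a \<Rightarrow> int. 4 * (\<Sum>i\<in>S. (y i)\<^sup>2) = (\<Sum>i\<in>S. (x i)\<^sup>2)"
proof -
  have "card S = Suc (Suc (Suc (Suc 0)))"
    using assms(1) by simp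
  then obtain a b c d where S: "S = {a, b, c, d}" and
    ne: "a \<noteq> b" "a \<noteq> c" "a \<noteq> d" "b \<noteq> c" "b \<noteq> d" "c \<noteq> d"
    by (auto simp: card_Suc_eq)
  obtain p q r s where "4 * (p\<^sup>2 + q\<^sup>2 + r\<^sup>2 + s\<^sup>2) = (x a)\<^sup>2 + (x b)\<^sup>2 + (x c)\<^sup>2 + (x d)\<^sup>2"
    using odd_four_squares[of "x a" "x b" "x c" "x d"] assms(2) S by auto
  then show ?thesis
    using ne by (intro exI[of _ "(\<lambda>_. 0)(a := p, b := q, c := r, d := s)"]) (simp add: S)
qed

lemma odd_squares_card_8:
  fixes x :: "'a \<Rightarrow> int"
  assumes S: "card S = 8" "\<And>i. i \<in> S \<Longrightarrow> odd (x i)"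
  shows "\<exists>y::'a \<Rightarrow> int. 4 * (\<Sum>i\<in>S. (y i)\<^sup>2) = (\<Sum>i\<in>S. (x i)\<^sup>2)"
proof -
  have fin: "finite S"
    using S(1) card.infinite by fastforce
  obtain T where T: "T \<subseteq> S" "card T = 4"
    using obtain_subset_with_card_n[of 4 S] S(1) by (metis numeral_Bit0 le_add1)
  then have c: "card (S - T) = 4"
    using S(1) card_Diff_subset[OF finite_subset[OF T(1) fin] T(1)] by simp
  obtain y where y: "4 * (\<Sum>i\<in>T. (y i)\<^sup>2) = (\<Sum>i\<in>T. (x i)\<^sup>2)"
    using odd_squares_card_4[OF T(2), of x] S(2) T(1) by blast
  obtain z where z: "4 * (\<Sum>i\<in>S - T. (z i)\<^sup>2) = (\<Sum>i\<in>S - T. (x i)\<^sup>2)"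
    using odd_squares_card_4[OF c, of x] S(2) by blast
  have "4 * (\<Sum>i\<in>S. (if i \<in> T then y i else z i)\<^sup>2) = (\<Sum>i\<in>S. (x i)\<^sup>2)"
    unfolding sum.subset_diff[OF T(1) fin] distrib_left
    using y z by simp
  then show ?thesis
    by (intro exI[of _ "\<lambda>i. if i \<in> T then y i else z i"])
qed

section \<open>The Fejer kernel and Poisson summation\<close>

definition fejer_weight :: "nat \<Rightarrow> int \<Rightarrow> real" where
  "fejer_weight N k = 1 - \<bar>of_int k\<bar> / (real N + 1)"

definition fejer :: "nat \<Rightarrow> real \<Rightarrow> real" where
  "fejer N u = (\<Sum>k = - int N..int N. fejer_weight N k * cos (2 * pi * of_int k * u))"

lemma sum_symmetric_Suc:
  fixes f :: "int \<Rightarrow> 'a::comm_monoid_add"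
  shows "(\<Sum>k = - int (Suc N)..int (Suc N). f k)
    = f (int (Suc N)) + (f (- int (Suc N)) + (\<Sum>k = - int N..int N. f k))"
proof -
  have "{- int (Suc N)..int (Suc N)} = insert (int (Suc N)) (insert (- int (Suc N)) {- int N..int N})"
    by auto
  then show ?thesis by simp
qed

text \<open>The reversed index \<open>Suc N - j\<close> is the form in which the cross terms arise
  in \<open>fejer_eq_square\<close>.\<close>

lemma dirichlet_cos_sum:
  "1 + 2 * (\<Sum>j\<le>N. cos (2 * pi * real (Suc N - j) * u)) = (\<Sum>k = - int (Suc N)..int (Suc N). cos (2 * pi * of_int k * u))"
proof -
  have "(\<Sum>k = - int M..int M. cos (2 * pi * of_int k * u)) = 1 + 2 * (\<Sum>j<M. cos (2 * pi * real (Suc j) * u))" for M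
  proof (induction M)
    case (Suc M)
    have "cos (2 * pi * of_int (- int (Suc M)) * u) = cos (2 * pi * of_int (int (Suc M)) * u)"
      using cos_minus[of "2 * pi * of_int (int (Suc M)) * u"] by (simp add: algebra_simps)
    then show ?case
      unfolding sum_symmetric_Suc Suc by simp
  qed simp
  moreover have "(\<Sum>j<Suc N. cos (2 * pi * real (Suc j) * u)) = (\<Sum>j<Suc N. cos (2 * pi * real (Suc N - j) * u))"
    by (subst sum.nat_diff_reindex[symmetric]) (auto intro!: sum.cong simp: Suc_diff_Suc of_nat_diff)
  ultimately show ?thesis
    by (simp only: lessThan_Suc_atMost)
qed

text \<open>The right side is the squared modulus of the exponential sum over j \<le> N, in which a
  difference d of indices occurs N + 1 - |d| times. In the induction the new exponential adds 1 and
  its cross terms, together a Dirichlet sum.\<close>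

lemma fejer_eq_square:
  "(real N + 1) * fejer N u
    = (\<Sum>j\<le>N. cos (2 * pi * real j * u))\<^sup>2 + (\<Sum>j\<le>N. sin (2 * pi * real j * u))\<^sup>2"
proof -
  define c s where "c N = (\<Sum>j\<le>N. cos (2 * pi * real j * u))" and "s N = (\<Sum>j\<le>N. sin (2 * pi * real j * u))" for N
  have "(\<Sum>k = - int N..int N. (real N + 1 - \<bar>of_int k\<bar>) * cos (2 * pi * of_int k * u)) = (c N)\<^sup>2 + (s N)\<^sup>2"
  proof (induction N)
    case (Suc N)
    let ?e = "2 * pi * real (Suc N) * u"
    have "(c (Suc N))\<^sup>2 + (s (Suc N))\<^sup>2
        = (c N)\<^sup>2 + (s N)\<^sup>2 + ((cos ?e)\<^sup>2 + (sin ?e)\<^sup>2) + 2 * (c N * cos ?e + s N * sin ?e)"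
      by (simp add: c_def s_def power2_eq_square algebra_simps)
    also have "c N * cos ?e + s N * sin ?e = (\<Sum>j\<le>N. cos (2 * pi * real (Suc N - j) * u))"
      unfolding c_def s_def sum_distrib_right sum.distrib[symmetric]
    proof (intro sum.cong refl)
      fix j assume "j \<in> {..N}"
      then have "2 * pi * real (Suc N - j) * u = ?e - 2 * pi * real j * u"
        by (simp add: of_nat_diff algebra_simps)
      then show "cos (2 * pi * real j * u) * cos ?e + sin (2 * pi * real j * u) * sin ?e
          = cos (2 * pi * real (Suc N - j) * u)"
        by (simp only: cos_diff) (simp only: mult.commute)
    qed
    also have "(c N)\<^sup>2 + (s N)\<^sup>2 + ((cos ?e)\<^sup>2 + (sin ?e)\<^sup>2) + 2 * \<dots>
        = (c N)\<^sup>2 + (s N)\<^sup>2 + (\<Sum>k = - int (Suc N)..int (Suc N). cos (2 * pi * of_int k * u))"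
      unfolding dirichlet_cos_sum[symmetric] by simp
    also have "\<dots> = (\<Sum>k = - int N..int N. (real N + 1 - \<bar>of_int k\<bar>) * cos (2 * pi * of_int k * u) + cos (2 * pi * of_int k * u))
        + (cos (2 * pi * of_int (int (Suc N)) * u) + cos (2 * pi * of_int (- int (Suc N)) * u))"
      unfolding Suc.IH[symmetric] sum_symmetric_Suc sum.distrib by simp
    also have "\<dots> = (\<Sum>k = - int (Suc N)..int (Suc N). (real (Suc N) + 1 - \<bar>of_int k\<bar>) * cos (2 * pi * of_int k * u))"
      unfolding sum_symmetric_Suc by (simp add: algebra_simps)
    finally show ?case ..
  qed (simp add: c_def s_def)
  moreover have "(real N + 1) * fejer N u
      = (\<Sum>k = - int N..int N. (real N + 1 - \<bar>of_int k\<bar>) * cos (2 * pi * of_int k * u))"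
    unfolding fejer_def fejer_weight_def sum_distrib_left
    by (intro sum.cong refl) (simp add: field_simps)
  ultimately show ?thesis
    by (simp add: c_def s_def)
qed

lemma fejer_nonneg: "0 \<le> fejer N u"
proof -
  have "0 \<le> (real N + 1) * fejer N u"
    unfolding fejer_eq_square by simp
  then show ?thesis
    by (simp add: zero_le_mult_iff)
qed

lemma fejer_weight_nonneg: "k \<in> {- int N..int N} \<Longrightarrow> 0 \<le> fejer_weight N k"
  by (auto simp: fejer_weight_def divide_simps)

lemma fejer_weight_le_1: "fejer_weight N k \<le> 1"
  by (simp add: fejer_weight_def)

lemma fejer_weight_tendsto: "(\<lambda>N. fejer_weight N k) \<longlonglongrightarrow> 1"
  unfolding fejer_weight_def by real_asymp

lemma fejer_eq_exp:
  "complex_of_real (fejer N u)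
    = (\<Sum>k = - int N..int N. of_real (fejer_weight N k) * exp (- 2 * of_real pi * \<i> * of_real (u * of_int k)))"
proof -
  have e: "exp (- 2 * of_real pi * \<i> * of_real (u * of_int k))
      = Complex (cos (2 * pi * of_int k * u)) (- sin (2 * pi * of_int k * u))" for k
  proof -
    have "- 2 * of_real pi * \<i> * of_real (u * of_int k) = \<i> * of_real (- (2 * pi * of_int k * u))"
      by simp
    then show ?thesis
      by (simp only: cis_conv_exp[symmetric]) (simp add: cis.ctr)
  qed
  define S where "S = (\<Sum>k = - int N..int N. fejer_weight N k * sin (2 * pi * of_int k * u))"
  have "S = (\<Sum>k = - int N..int N. fejer_weight N (- k) * sin (2 * pi * of_int (- k) * u))"
    unfolding S_def by (rule sum.reindex_bij_witness[of _ uminus uminus]) auto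
  also have "\<dots> = - S"
    unfolding S_def by (simp add: fejer_weight_def sum_negf)
  finally have "S = 0" by simp
  then show ?thesis
    unfolding e S_def fejer_def by (simp add: complex_eq_iff sum_negf)
qed

lemma borel_measurable_fejer [measurable]: "fejer N \<in> borel_measurable borel"
  unfolding fejer_def by measurable

text \<open>Half-open so that the cells partition the line, and centred at integers because there
  the kernel concentrates.\<close>

abbreviation unit_cell :: "int \<Rightarrow> real set" where
  "unit_cell m \<equiv> {of_int m - 1 / 2..<of_int m + 1 / 2}"

lemma has_bochner_integral_cos_unit_cell:
  "has_bochner_integral lborel (\<lambda>u. cos (2 * pi * of_int k * u) * indicat_real (unit_cell m) u) (if k = 0 then 1 else 0)"
proof -
  let ?I = "{of_int m - 1 / 2..of_int m + 1 / 2 :: real}"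
  let ?F = "\<lambda>u. if k = 0 then u else sin (2 * pi * of_int k * u) / (2 * pi * of_int k)"
  have "has_bochner_integral lborel (\<lambda>u. cos (2 * pi * of_int k * u) * indicat_real ?I u)
      (?F (of_int m + 1 / 2) - ?F (of_int m - 1 / 2))"
    by (rule has_bochner_integral_FTC_Icc_real) (cases "k = 0"; auto intro!: derivative_eq_intros)+
  moreover have "?F (of_int m + 1 / 2) - ?F (of_int m - 1 / 2) = (if k = 0 then 1 else 0)"
  proof -
    have "sin (2 * pi * of_int k * (of_int m + 1 / 2)) = 0"
      using sin_times_pi_eq_0[of "of_int (2 * k * m + k) :: real"] by (simp add: algebra_simps)
    moreover have "sin (2 * pi * of_int k * (of_int m - 1 / 2)) = 0"
      using sin_times_pi_eq_0[of "of_int (2 * k * m - k) :: real"] by (simp add: algebra_simps)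
    ultimately show ?thesis by simp
  qed
  ultimately have "has_bochner_integral lborel (\<lambda>u. cos (2 * pi * of_int k * u) * indicat_real ?I u) (if k = 0 then 1 else 0)"
    by simp
  moreover have "AE u in lborel. cos (2 * pi * of_int k * u) * indicat_real ?I u
      = cos (2 * pi * of_int k * u) * indicat_real (unit_cell m) u"
    using AE_lborel_singleton[of "of_int m + 1 / 2 :: real"]
    by eventually_elim (auto simp: indicator_def)
  ultimately show ?thesis
    by (subst (asm) has_bochner_integral_cong_AE) auto
qed

lemma has_bochner_integral_fejer_unit_cell:
  "has_bochner_integral lborel (\<lambda>u. fejer N u * indicat_real (unit_cell m) u) 1"
proof -
  have "has_bochner_integral lborel
      (\<lambda>u. \<Sum>k = - int N..int N. fejer_weight N k * (cos (2 * pi * of_int k * u) * indicat_real (unit_cell m) u))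
      (\<Sum>k = - int N..int N. fejer_weight N k * (if k = 0 then 1 else 0))"
    by (intro has_bochner_integral_sum has_bochner_integral_mult_right has_bochner_integral_cos_unit_cell)
  moreover have "(\<Sum>k = - int N..int N. fejer_weight N k * (if k = 0 then 1 else 0)) = 1"
    by (simp add: if_distrib fejer_weight_def cong: if_cong)
  ultimately show ?thesis
    by (simp add: fejer_def sum_distrib_right mult.assoc)
qed

text \<open>Since sin^2 (pi * u) = (1 - cos (2 * pi * u)) / 2, only the frequencies 0, 1 and -1
  contribute, giving half the difference of the weights at 0 and 1.\<close>

lemma has_bochner_integral_sin_fejer_unit_cell:
  "has_bochner_integral lborel (\<lambda>u. (sin (pi * u))\<^sup>2 * (fejer N u * indicat_real (unit_cell m) u))
     (1 / (2 * (real N + 1)))"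
proof -
  let ?i = "indicat_real (unit_cell m)"
  have "has_bochner_integral lborel
      (\<lambda>u. \<Sum>k = - int N..int N. fejer_weight N k *
         (1 / 2 * (cos (2 * pi * of_int (k + 1) * u) * ?i u) + 1 / 2 * (cos (2 * pi * of_int (k - 1) * u) * ?i u)))
      (\<Sum>k = - int N..int N. fejer_weight N k *
         (1 / 2 * (if k + 1 = 0 then 1 else 0) + 1 / 2 * (if k - 1 = 0 then 1 else 0)))"
    by (intro has_bochner_integral_sum has_bochner_integral_mult_right has_bochner_integral_add
        has_bochner_integral_cos_unit_cell)
  moreover have "(\<Sum>k = - int N..int N. fejer_weight N k *
         (1 / 2 * (if k + 1 = 0 then 1 else 0) + 1 / 2 * (if k - 1 = 0 then 1 else 0))) = 1 - 1 / (real N + 1)"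
    (is "?s = _")
  proof -
    have "?s = (\<Sum>k = - int N..int N. (if k = - 1 then fejer_weight N k / 2 else 0) + (if k = 1 then fejer_weight N k / 2 else 0))"
      by (intro sum.cong) auto
    \<comment> \<open>For N = 0 the frequencies 1 and -1 are out of range, but then the right side
      is 0 as well.\<close>
    also have "\<dots> = 1 - 1 / (real N + 1)"
      unfolding sum.distrib by (cases N) (simp_all add: fejer_weight_def)
    finally show ?thesis .
  qed
  moreover have "(\<Sum>k = - int N..int N. fejer_weight N k *
         (1 / 2 * (cos (2 * pi * of_int (k + 1) * u) * ?i u) + 1 / 2 * (cos (2 * pi * of_int (k - 1) * u) * ?i u)))
      = cos (2 * pi * u) * (fejer N u * ?i u)" for u
  proof -
    have half: "1 / 2 * (a * i) + 1 / 2 * (b * i) = x * (y * i)" if "a + b = 2 * (x * y)" for a b i x y :: real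
    proof -
      have "1 / 2 * (a * i) + 1 / 2 * (b * i) = (a + b) * i / 2"
        by (simp add: algebra_simps add_divide_distrib)
      then show ?thesis
        by (simp add: that)
    qed
    have "1 / 2 * (cos (2 * pi * of_int (k + 1) * u) * ?i u) + 1 / 2 * (cos (2 * pi * of_int (k - 1) * u) * ?i u)
        = cos (2 * pi * u) * (cos (2 * pi * of_int k * u) * ?i u)" for k
    proof -
      have "cos (2 * pi * of_int (k + 1) * u) + cos (2 * pi * of_int (k - 1) * u)
          = 2 * (cos (2 * pi * u) * cos (2 * pi * of_int k * u))"
        using cos_add[of "2 * pi * of_int k * u" "2 * pi * u"] cos_diff[of "2 * pi * of_int k * u" "2 * pi * u"]
        by (simp add: algebra_simps)
      then show ?thesis
        by (rule half)
    qed
    then show ?thesis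
      by (simp add: fejer_def sum_distrib_right sum_distrib_left mult_ac)
  qed
  ultimately have "has_bochner_integral lborel (\<lambda>u. cos (2 * pi * u) * (fejer N u * ?i u)) (1 - 1 / (real N + 1))"
    by simp
  then have "has_bochner_integral lborel (\<lambda>u. 1 / 2 * (fejer N u * ?i u - cos (2 * pi * u) * (fejer N u * ?i u)))
      (1 / 2 * (1 - (1 - 1 / (real N + 1))))"
    by (intro has_bochner_integral_mult_right has_bochner_integral_diff has_bochner_integral_fejer_unit_cell)
  moreover have "1 / 2 * (fejer N u * ?i u - cos (2 * pi * u) * (fejer N u * ?i u))
      = (sin (pi * u))\<^sup>2 * (fejer N u * ?i u)" for u
  proof -
    have "cos (2 * pi * u) = 1 - 2 * (sin (pi * u))\<^sup>2"
      using cos_double_sin[of "pi * u"] by (simp add: mult.assoc)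
    then show ?thesis
      by (simp add: left_diff_distrib)
  qed
  ultimately show ?thesis
    by simp
qed

section \<open>Integrals and sums of products over the coordinates\<close>

lemma measurable_vec_nth_real [measurable]: "(\<lambda>y::real^'n. y $ i) \<in> borel_measurable borel"
  by (intro borel_measurable_continuous_onI continuous_intros)

lemma nn_integral_lborel_vec_prod:
  fixes f :: "'n::finite \<Rightarrow> real \<Rightarrow> ennreal"
  assumes "\<And>i. f i \<in> borel_measurable borel"
  shows "(\<integral>\<^sup>+y. (\<Prod>i\<in>UNIV. f i ((y :: real^'n) $ i)) \<partial>lborel) = (\<Prod>i\<in>UNIV. \<integral>\<^sup>+u. f i u \<partial>lborel)"
proof -
  let ?a = "\<lambda>i::'n. axis i (1::real)"
  have inj: "inj ?a"
    by (auto intro!: injI simp: axis_eq_axis)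
  have B: "prod F (Basis :: (real^'n) set) = (\<Prod>i\<in>UNIV. F (?a i))" for F :: "real^'n \<Rightarrow> ennreal"
  proof -
    have "(Basis :: (real^'n) set) = range ?a"
      by (auto simp: Basis_vec_def)
    then show ?thesis
      using prod.reindex[OF inj, of F] by (simp only: o_def)
  qed
  show ?thesis
    using nn_integral_lborel_prod[of "\<lambda>b. f (inv_into UNIV ?a b)"] assms
    by (simp add: B inv_f_f[OF inj] inner_axis)
qed

lemma has_bochner_integral_lborel_vec_prod:
  fixes f :: "'n::finite \<Rightarrow> real \<Rightarrow> real"
  assumes f: "\<And>i. has_bochner_integral lborel (f i) (c i)" and nonneg: "\<And>i u. 0 \<le> f i u"
  shows "has_bochner_integral lborel (\<lambda>y::real^'n. \<Prod>i\<in>UNIV. f i (y $ i)) (\<Prod>i\<in>UNIV. c i)"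
proof (rule has_bochner_integral_nn_integral)
  have meas [measurable]: "f i \<in> borel_measurable borel" for i
    using borel_measurable_has_bochner_integral[OF f[of i]] by simp
  show "(\<lambda>y::real^'n. \<Prod>i\<in>UNIV. f i (y $ i)) \<in> borel_measurable lborel"
    by measurable
  have c: "0 \<le> c i" for i
    using f nonneg by (metis Bochner_Integration.integral_nonneg has_bochner_integral_integral_eq)
  show "0 \<le> (\<Prod>i\<in>UNIV. c i)"
    by (intro prod_nonneg) (use c in auto)
  have "(\<integral>\<^sup>+y. ennreal (\<Prod>i\<in>UNIV. f i ((y :: real^'n) $ i)) \<partial>lborel)
      = (\<integral>\<^sup>+y. (\<Prod>i\<in>UNIV. ennreal (f i ((y :: real^'n) $ i))) \<partial>lborel)"
    by (simp add: prod_ennreal nonneg)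
  also have "\<dots> = (\<Prod>i\<in>UNIV. \<integral>\<^sup>+u. ennreal (f i u) \<partial>lborel)"
    by (rule nn_integral_lborel_vec_prod) measurable
  also have "\<dots> = (\<Prod>i\<in>UNIV. ennreal (c i))"
  proof (rule prod.cong[OF refl])
    fix i
    show "(\<integral>\<^sup>+u. ennreal (f i u) \<partial>lborel) = ennreal (c i)"
      using f[of i] nonneg by (subst nn_integral_eq_integral) (auto simp: has_bochner_integral_iff)
  qed
  also have "\<dots> = ennreal (\<Prod>i\<in>UNIV. c i)"
    using c by (simp add: prod_ennreal)
  finally show "(\<integral>\<^sup>+y. ennreal (\<Prod>i\<in>UNIV. f i ((y :: real^'n) $ i)) \<partial>lborel) = ennreal (\<Prod>i\<in>UNIV. c i)" .
qed (simp add: prod_nonneg nonneg)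

text \<open>A finite set of functions lies in the box of its coordinate projections, over which the
  sum factorises; nonnegativity permits the enlargement.\<close>

lemma summable_on_prod_fun:
  fixes f :: "'i::finite \<Rightarrow> 'a \<Rightarrow> real"
  assumes s: "\<And>i. f i summable_on UNIV" and nonneg: "\<And>i x. 0 \<le> f i x"
  shows "(\<lambda>z. \<Prod>i\<in>UNIV. f i (z i)) summable_on UNIV"
proof (rule nonneg_bdd_above_summable_on)
  show "bdd_above (sum (\<lambda>z. \<Prod>i\<in>UNIV. f i (z i)) ` {F. F \<subseteq> UNIV \<and> finite F})"
  proof (rule bdd_aboveI2)
    fix F :: "('i \<Rightarrow> 'a) set" assume "F \<in> {F. F \<subseteq> UNIV \<and> finite F}"
    then have fin: "finite F" by simp
    have "(\<Sum>z\<in>F. \<Prod>i\<in>UNIV. f i (z i)) \<le> (\<Sum>z\<in>PiE UNIV (\<lambda>i. (\<lambda>z. z i) ` F). \<Prod>i\<in>UNIV. f i (z i))"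
      using fin by (intro sum_mono2 finite_PiE) (auto intro: prod_nonneg nonneg)
    also have "\<dots> = (\<Prod>i\<in>UNIV. \<Sum>x\<in>(\<lambda>z. z i) ` F. f i x)"
      using fin by (intro prod_sum_PiE[symmetric]) auto
    also have "\<dots> \<le> (\<Prod>i\<in>UNIV. infsum (f i) UNIV)"
      using fin s by (intro prod_mono conjI finite_sum_le_infsum sum_nonneg) (auto simp: nonneg)
    finally show "(\<Sum>z\<in>F. \<Prod>i\<in>UNIV. f i (z i)) \<le> (\<Prod>i\<in>UNIV. infsum (f i) UNIV)" .
  qed
qed (simp add: prod_nonneg nonneg)

lemma lborel_integral_norm_le:
  fixes f :: "'a::euclidean_space \<Rightarrow> 'b::{banach, second_countable_topology}"
  assumes g: "integrable lborel g" and le: "\<And>x. norm (f x) \<le> g x"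
  shows "norm (LINT x|lborel. f x) \<le> (LINT x|lborel. g x)"
proof -
  have "norm (LINT x|lborel. f x) \<le> (LINT x|lborel. norm (f x))"
    by (rule Bochner_Integration.integral_norm_bound)
  also have "\<dots> \<le> (LINT x|lborel. g x)"
    using le by (intro Bochner_Integration.integral_mono' g) (auto intro: order_trans[OF norm_ge_zero])
  finally show ?thesis .
qed

section \<open>Unit cubes and the product kernel\<close>

definition ivec :: "('n \<Rightarrow> int) \<Rightarrow> real^'n" where
  "ivec z = (\<chi> i. of_int (z i))"

lemma ivec_nth [simp]: "ivec z $ i = of_int (z i)"
  by (simp add: ivec_def)

definition unit_cube :: "('n \<Rightarrow> int) \<Rightarrow> (real^'n) set" where
  "unit_cube z = {y. \<forall>i. y $ i \<in> unit_cell (z i)}"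

text \<open>In this form disjointness and covering of the cubes are immediate.\<close>

lemma mem_unit_cube_iff: "y \<in> unit_cube z \<longleftrightarrow> z = (\<lambda>i. \<lfloor>y $ i + 1 / 2\<rfloor>)"
proof -
  have "y $ i \<in> unit_cell (z i) \<longleftrightarrow> z i = \<lfloor>y $ i + 1 / 2\<rfloor>" for i
    by (auto simp: eq_commute[of "z i"] floor_eq_iff)
  then show ?thesis
    by (auto simp: unit_cube_def fun_eq_iff)
qed

lemma unit_cube_measurable [measurable]: "unit_cube z \<in> sets borel"
  unfolding unit_cube_def by measurable

definition fejer_kernel :: "nat \<Rightarrow> real^'n \<Rightarrow> real" where
  "fejer_kernel N y = (\<Prod>i\<in>UNIV. fejer N (y $ i))"

lemma fejer_kernel_nonneg: "0 \<le> fejer_kernel N y"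
  by (simp add: fejer_kernel_def prod_nonneg fejer_nonneg)

lemma fejer_kernel_measurable [measurable]: "fejer_kernel N \<in> borel_measurable borel"
  unfolding fejer_kernel_def by measurable

lemma indicator_unit_cube: "indicat_real (unit_cube z) y = (\<Prod>i\<in>UNIV. indicat_real (unit_cell (z i)) (y $ i))"
proof (cases "y \<in> unit_cube z")
  case True
  then show ?thesis
    by (simp add: unit_cube_def)
next
  case False
  then obtain i where "y $ i \<notin> unit_cell (z i)"
    by (auto simp: unit_cube_def)
  then have "(\<Prod>i\<in>UNIV. indicat_real (unit_cell (z i)) (y $ i)) = 0"
    by (intro prod_zero bexI[of _ i]) (simp_all add: indicator_def)
  then show ?thesis
    using False by simp
qed

lemma has_bochner_integral_fejer_kernel_cube:
  "has_bochner_integral lborel (\<lambda>y. fejer_kernel N y * indicat_real (unit_cube z) y) 1"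
  using has_bochner_integral_lborel_vec_prod
    [where f = "\<lambda>i u. fejer N u * indicat_real (unit_cell (z i)) u" and c = "\<lambda>_. 1"]
  by (simp add: fejer_kernel_def indicator_unit_cube prod.distrib fejer_nonneg
      has_bochner_integral_fejer_unit_cell)

lemma has_bochner_integral_sin_fejer_kernel_cube:
  "has_bochner_integral lborel (\<lambda>y. (sin (pi * (y $ i)))\<^sup>2 * (fejer_kernel N y * indicat_real (unit_cube z) y))
     (1 / (2 * (real N + 1)))"
proof -
  have "has_bochner_integral lborel
      (\<lambda>y. \<Prod>j\<in>UNIV. (if j = i then (sin (pi * (y $ j)))\<^sup>2 else 1) * (fejer N (y $ j) * indicat_real (unit_cell (z j)) (y $ j)))
      (\<Prod>j\<in>UNIV. if j = i then 1 / (2 * (real N + 1)) else 1)"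
  proof (rule has_bochner_integral_lborel_vec_prod)
    fix j
    show "has_bochner_integral lborel
        (\<lambda>u. (if j = i then (sin (pi * u))\<^sup>2 else 1) * (fejer N u * indicat_real (unit_cell (z j)) u))
        (if j = i then 1 / (2 * (real N + 1)) else 1)"
      using has_bochner_integral_sin_fejer_unit_cell[of N "z j"] has_bochner_integral_fejer_unit_cell[of N "z j"]
      by (cases "j = i") simp_all
  qed (simp add: fejer_nonneg)
  moreover have "(\<Prod>j\<in>UNIV. if j = i then (sin (pi * (y $ j)))\<^sup>2 else 1) = (sin (pi * (y $ i)))\<^sup>2" for y :: "real^'a"
    by (simp add: prod.delta)
  ultimately show ?thesis
    by (simp add: fejer_kernel_def indicator_unit_cube prod.distrib)
qed

text \<open>Korovkin's argument: the deviation of \<open>g\<close> from its value at the centre of the cube is at most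
  \<open>\<epsilon>\<close> plus a multiple of \<open>\<Sum>i. (sin (pi * y\<^sub>i))\<^sup>2\<close>, whose integral against the kernel tends to 0.\<close>

lemma fejer_kernel_cube_tendsto:
  fixes g :: "real^'n \<Rightarrow> complex"
  assumes cont: "continuous_on UNIV g" and bound: "\<And>y. norm (g y) \<le> B"
  shows "(\<lambda>N. LINT y|lborel. (fejer_kernel N y * indicat_real (unit_cube z) y) *\<^sub>R g y) \<longlonglongrightarrow> g (ivec z)"
proof (rule tendstoI)
  fix \<epsilon> :: real assume "0 < \<epsilon>"
  define k where "k N y = fejer_kernel N y * indicat_real (unit_cube z) y" for N y
  have k_nonneg: "0 \<le> k N y" for N y
    by (simp add: k_def fejer_kernel_nonneg)
  have k_int: "has_bochner_integral lborel (k N) 1" for N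
    unfolding k_def by (rule has_bochner_integral_fejer_kernel_cube)
  have [measurable]: "g \<in> borel_measurable borel"
    using cont by (rule borel_measurable_continuous_onI)
  have [measurable]: "k N \<in> borel_measurable borel" for N
    unfolding k_def by measurable
  have B: "0 \<le> B"
    using bound[of 0] norm_ge_zero[of "g 0"] by linarith
  obtain d where d: "0 < d" "\<And>y. dist y (ivec z) < d \<Longrightarrow> dist (g y) (g (ivec z)) < \<epsilon> / 2"
    using cont \<open>0 < \<epsilon>\<close> unfolding continuous_on_iff by (metis UNIV_I half_gt_zero)
  \<comment> \<open>The bound 1/2 keeps pi * \<delta> where the sine increases; division by the
    dimension makes the l1 estimate of the norm stay below \<open>d\<close>.\<close>
  define \<delta> where "\<delta> = min (1 / 2) (d / CARD('n))"
  have \<delta>: "0 < \<delta>" "\<delta> \<le> 1 / 2" "\<delta> * CARD('n) \<le> d"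
    using d by (auto simp: \<delta>_def min_def field_simps)
  define s where "s = (sin (pi * \<delta>))\<^sup>2"
  have s: "0 < s"
    using \<delta> sin_gt_zero[of "pi * \<delta>"] by (auto simp: s_def)
  \<comment> \<open>Chosen so that M * s = 2 * B, the trivial bound for the deviation of
    \<open>g\<close>.\<close>
  define M where "M = 2 * B / s"
  have M: "0 \<le> M"
    using B s by (simp add: M_def)
  have pw: "norm (g y - g (ivec z)) \<le> \<epsilon> / 2 + M * (\<Sum>i\<in>UNIV. (sin (pi * (y $ i)))\<^sup>2)"
    if y: "y \<in> unit_cube z" for y
  proof (cases "\<forall>i. \<bar>y $ i - of_int (z i)\<bar> < \<delta>")
    case True
    have "norm (y - ivec z) \<le> (\<Sum>i\<in>UNIV. \<bar>(y - ivec z) $ i\<bar>)"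
      by (rule norm_le_l1_cart)
    also have "\<dots> < (\<Sum>i\<in>(UNIV :: 'n set). \<delta>)"
      using True by (intro sum_strict_mono) auto
    finally have "norm (y - ivec z) < d"
      using \<delta>(3) by (simp add: mult.commute)
    then have "norm (g y - g (ivec z)) < \<epsilon> / 2"
      using d(2)[of y] by (simp add: dist_norm)
    then show ?thesis
      using M by (smt (verit) mult_nonneg_nonneg sum_nonneg zero_le_power2)
  next
    case False
    then obtain i where i: "\<delta> \<le> \<bar>y $ i - of_int (z i)\<bar>"
      by (auto simp: not_less)
    define v where "v = y $ i - of_int (z i)"
    have v: "\<delta> \<le> \<bar>v\<bar>" "\<bar>v\<bar> \<le> 1 / 2"
    proof -
      have "of_int (z i) - 1 / 2 \<le> y $ i" "y $ i < of_int (z i) + 1 / 2"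
        using y by (auto simp: unit_cube_def)
      then show "\<delta> \<le> \<bar>v\<bar>" "\<bar>v\<bar> \<le> 1 / 2"
        using i unfolding v_def by linarith+
    qed
    have "sin (pi * \<delta>) \<le> sin (pi * \<bar>v\<bar>)"
    proof (rule sin_monotone_2pi_le)
      have "0 \<le> pi * \<delta>"
        using \<delta> by simp
      then show "- (pi / 2) \<le> pi * \<delta>"
        using pi_gt_zero by linarith
      show "pi * \<delta> \<le> pi * \<bar>v\<bar>"
        by (rule mult_left_mono[OF v(1)]) simp
      show "pi * \<bar>v\<bar> \<le> pi / 2"
        using mult_left_mono[OF v(2), of pi] by simp
    qed
    then have "s \<le> (sin (pi * \<bar>v\<bar>))\<^sup>2"
      unfolding s_def using \<delta> sin_gt_zero[of "pi * \<delta>"] by (intro power_mono) auto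
    also have "(sin (pi * \<bar>v\<bar>))\<^sup>2 = (sin (pi * v))\<^sup>2"
      by (simp add: abs_if)
    also have "\<dots> = (sin (pi * (y $ i)))\<^sup>2"
    proof -
      have sz: "sin (pi * of_int (z i)) = 0"
        using sin_times_pi_eq_0[of "of_int (z i) :: real"] by (simp add: mult.commute)
      have "sin (pi * (y $ i)) = sin (pi * of_int (z i) + pi * v)"
        by (simp add: v_def algebra_simps)
      also have "\<dots> = cos (pi * of_int (z i)) * sin (pi * v)"
        by (simp add: sin_add sz)
      finally show ?thesis
        using sin_cos_squared_add[of "pi * of_int (z i)"] sz by (simp add: power_mult_distrib)
    qed
    also have "\<dots> \<le> (\<Sum>i\<in>UNIV. (sin (pi * (y $ i)))\<^sup>2)"
      by (rule member_le_sum) auto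
    finally have "M * s \<le> M * (\<Sum>i\<in>UNIV. (sin (pi * (y $ i)))\<^sup>2)"
      using M by (rule mult_left_mono)
    moreover have "M * s = 2 * B"
      using s by (simp add: M_def)
    moreover have "norm (g y - g (ivec z)) \<le> 2 * B"
      using norm_triangle_ineq4[of "g y" "g (ivec z)"] bound[of y] bound[of "ivec z"] by linarith
    ultimately show ?thesis
      using \<open>0 < \<epsilon>\<close> by linarith
  qed
  have int_kg: "integrable lborel (\<lambda>y. k N y *\<^sub>R g y)" for N
  proof (rule Bochner_Integration.integrable_bound)
    show "integrable lborel (\<lambda>y. B * k N y)"
      using k_int by (auto simp: has_bochner_integral_iff)
    show "AE y in lborel. norm (k N y *\<^sub>R g y) \<le> norm (B * k N y)"
      using bound B k_nonneg by (auto simp: abs_mult mult.commute[of B] intro!: mult_left_mono)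
  qed simp
  define R where "R N = \<epsilon> / 2 + M * (\<Sum>i\<in>(UNIV::'n set). 1 / (2 * (real N + 1)))" for N
  have est: "dist (LINT y|lborel. k N y *\<^sub>R g y) (g (ivec z)) \<le> R N" for N
  proof -
    have hb: "has_bochner_integral lborel
        (\<lambda>y. \<epsilon> / 2 * k N y + M * (\<Sum>i\<in>UNIV. (sin (pi * (y $ i)))\<^sup>2 * k N y)) (\<epsilon> / 2 * 1 + M * (\<Sum>i\<in>(UNIV::'n set). 1 / (2 * (real N + 1))))"
      unfolding k_def
      by (intro has_bochner_integral_add has_bochner_integral_mult_right has_bochner_integral_sum
          has_bochner_integral_fejer_kernel_cube has_bochner_integral_sin_fejer_kernel_cube)
    have "(LINT y|lborel. k N y *\<^sub>R g y) - g (ivec z) = (LINT y|lborel. k N y *\<^sub>R g y) - (LINT y|lborel. k N y *\<^sub>R g (ivec z))"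
      using k_int[of N] by (simp add: has_bochner_integral_iff)
    also have "\<dots> = (LINT y|lborel. k N y *\<^sub>R g y - k N y *\<^sub>R g (ivec z))"
      using int_kg k_int[of N] by (intro Bochner_Integration.integral_diff[symmetric]) (auto simp: has_bochner_integral_iff)
    also have "norm \<dots> \<le> (LINT y|lborel. \<epsilon> / 2 * k N y + M * (\<Sum>i\<in>UNIV. (sin (pi * (y $ i)))\<^sup>2 * k N y))"
    proof (rule lborel_integral_norm_le)
      show "integrable lborel (\<lambda>y. \<epsilon> / 2 * k N y + M * (\<Sum>i\<in>UNIV. (sin (pi * (y $ i)))\<^sup>2 * k N y))"
        using hb by (simp add: has_bochner_integral_iff)
      fix y :: "real^'n"
      show "norm (k N y *\<^sub>R g y - k N y *\<^sub>R g (ivec z)) \<le> \<epsilon> / 2 * k N y + M * (\<Sum>i\<in>UNIV. (sin (pi * (y $ i)))\<^sup>2 * k N y)"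
      proof (cases "y \<in> unit_cube z")
        case True
        have "norm (k N y *\<^sub>R g y - k N y *\<^sub>R g (ivec z)) = k N y * norm (g y - g (ivec z))"
          using k_nonneg[of N y] by (simp add: scaleR_diff_right[symmetric])
        also have "\<dots> \<le> k N y * (\<epsilon> / 2 + M * (\<Sum>i\<in>UNIV. (sin (pi * (y $ i)))\<^sup>2))"
          by (intro mult_left_mono pw True k_nonneg)
        finally show ?thesis
          by (simp add: algebra_simps sum_distrib_left sum_distrib_right)
      qed (simp add: k_def)
    qed
    also have "\<dots> = R N"
      using hb by (simp add: R_def has_bochner_integral_iff)
    finally show ?thesis
      by (simp add: dist_norm)
  qed
  have "R \<longlonglongrightarrow> \<epsilon> / 2"
    unfolding R_def sum_constant by real_asymp
  then have "eventually (\<lambda>N. R N < \<epsilon>) sequentially"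
    by (rule order_tendstoD) (use \<open>0 < \<epsilon>\<close> in simp)
  then show "\<forall>\<^sub>F N in sequentially. dist (LINT y|lborel. (fejer_kernel N y * indicat_real (unit_cube z) y) *\<^sub>R g y) (g (ivec z)) < \<epsilon>"
    by (rule eventually_mono) (rule le_less_trans[OF est[unfolded k_def]])
qed

section \<open>Rapidly decreasing functions\<close>

lemma integrable_inverse_1_plus_square_lborel: "integrable lborel (\<lambda>u::real. 1 / (1 + u\<^sup>2))"
  using integrable_inverse_1_plus_square by (simp add: set_integrable_def inverse_eq_divide)

text \<open>A product majorant reduces integrability and summability to one dimension. Complex
  values are allowed because modulation leaves the real-valued functions to which
  \<open>schwartz\<close> applies.\<close>

definition rapidly_decreasing :: "(real^'n \<Rightarrow> complex) \<Rightarrow> bool" where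
  "rapidly_decreasing g \<longleftrightarrow> continuous_on UNIV g \<and> (\<exists>C. \<forall>y. norm (g y) \<le> C * (\<Prod>i\<in>UNIV. 1 / (1 + (y $ i)\<^sup>2)))"

lemma rapidly_decreasingE:
  assumes "rapidly_decreasing g"
  obtains C where "0 \<le> C" "\<And>y. norm (g y) \<le> C * (\<Prod>i\<in>UNIV. 1 / (1 + (y $ i)\<^sup>2))"
proof -
  obtain C where C: "\<And>y. norm (g y) \<le> C * (\<Prod>i\<in>UNIV. 1 / (1 + (y $ i)\<^sup>2))"
    using assms by (auto simp: rapidly_decreasing_def)
  have "0 \<le> C"
    using order_trans[OF norm_ge_zero C[of 0]] by simp
  then show ?thesis
    using C that by blast
qed

lemma rapidly_decreasing_continuous: "rapidly_decreasing g \<Longrightarrow> continuous_on UNIV g"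
  by (simp add: rapidly_decreasing_def)

lemma rapidly_decreasing_measurable: "rapidly_decreasing g \<Longrightarrow> g \<in> borel_measurable borel"
  by (intro borel_measurable_continuous_onI rapidly_decreasing_continuous)

lemma rapidly_decreasing_integrable:
  fixes g :: "real^'n \<Rightarrow> complex"
  assumes "rapidly_decreasing g"
  shows "integrable lborel g"
proof -
  obtain C where C: "0 \<le> C" "\<And>y. norm (g y) \<le> C * (\<Prod>i\<in>UNIV. 1 / (1 + (y $ i)\<^sup>2))"
    using assms by (rule rapidly_decreasingE) blast
  have "has_bochner_integral lborel (\<lambda>y::real^'n. \<Prod>i\<in>UNIV. 1 / (1 + (y $ i)\<^sup>2))
      (\<Prod>i\<in>(UNIV::'n set). LINT u|lborel. 1 / (1 + u\<^sup>2))"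
    by (rule has_bochner_integral_lborel_vec_prod)
       (auto intro: has_bochner_integral_integrable integrable_inverse_1_plus_square_lborel)
  then have "integrable lborel (\<lambda>y::real^'n. C * (\<Prod>i\<in>UNIV. 1 / (1 + (y $ i)\<^sup>2)))"
    by (auto simp: has_bochner_integral_iff)
  then show ?thesis
  proof (rule Bochner_Integration.integrable_bound)
    show "g \<in> borel_measurable lborel"
      using rapidly_decreasing_measurable[OF assms] by simp
    show "AE y in lborel. norm (g y) \<le> norm (C * (\<Prod>i\<in>UNIV. 1 / (1 + (y $ i)\<^sup>2)))"
      using C by (auto intro!: AE_I2 order_trans[OF C(2)])
  qed
qed

lemma rapidly_decreasing_cube_bound:
  assumes "norm (g y) \<le> C * (\<Prod>i\<in>UNIV. 1 / (1 + (y $ i)\<^sup>2))" "0 \<le> C" "y \<in> unit_cube z"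
  shows "norm (g y) \<le> C * (\<Prod>i\<in>UNIV. 2 / (1 + (of_int (z i))\<^sup>2))"
proof -
  have "(\<Prod>i\<in>UNIV. 1 / (1 + (y $ i)\<^sup>2)) \<le> (\<Prod>i\<in>UNIV. 2 / (1 + (of_int (z i))\<^sup>2))"
  proof (intro prod_mono conjI)
    fix i
    have "of_int (z i) - 1 / 2 \<le> y $ i" "y $ i < of_int (z i) + 1 / 2"
      using assms(3) by (auto simp: unit_cube_def)
    then have "\<bar>y $ i - of_int (z i)\<bar> \<le> 1 / 2"
      by linarith
    then show "1 / (1 + (y $ i)\<^sup>2) \<le> 2 / (1 + (of_int (z i))\<^sup>2)"
      using inverse_1_plus_square_shift[of "y $ i - of_int (z i)" "of_int (z i)"] by simp
  qed simp
  then show ?thesis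
    using assms(1,2) by (meson mult_left_mono order_trans)
qed

lemma summable_on_cube_bound:
  "(\<lambda>z::'n::finite \<Rightarrow> int. C * (\<Prod>i\<in>UNIV. 2 / (1 + (of_int (z i))\<^sup>2)) :: real) summable_on UNIV"
proof (intro summable_on_cmult_right summable_on_prod_fun)
  show "(\<lambda>m::int. 2 / (1 + (of_int m)\<^sup>2) :: real) summable_on UNIV"
    using summable_on_cmult_right[OF summable_on_inverse_1_plus_square_int, of 2] by simp
qed simp

lemma rapidly_decreasing_summable:
  fixes g :: "real^'n \<Rightarrow> complex"
  assumes "rapidly_decreasing g"
  shows "(\<lambda>z. norm (g (ivec z))) summable_on UNIV"
proof -
  obtain C where C: "0 \<le> C" "\<And>y. norm (g y) \<le> C * (\<Prod>i\<in>UNIV. 1 / (1 + (y $ i)\<^sup>2))"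
    using assms by (rule rapidly_decreasingE) blast
  show ?thesis
  proof (rule summable_on_comparison_test[OF summable_on_cube_bound[of C]])
    show "norm (g (ivec z)) \<le> C * (\<Prod>i\<in>UNIV. 2 / (1 + (of_int (z i))\<^sup>2))" for z
      by (rule rapidly_decreasing_cube_bound[OF C(2) C(1)]) (simp add: unit_cube_def)
  qed simp
qed

section \<open>Poisson summation in Fejer means\<close>

lemma fejer_kernel_eq_exp:
  "complex_of_real (fejer_kernel N y)
    = (\<Sum>k\<in>PiE UNIV (\<lambda>_. {- int N..int N}). of_real (\<Prod>i\<in>UNIV. fejer_weight N (k i)) *
         exp (- 2 * of_real pi * \<i> * of_real (y \<bullet> ivec k)))"
proof -
  have "complex_of_real (fejer_kernel N y) = (\<Prod>i\<in>UNIV. \<Sum>k = - int N..int N. of_real (fejer_weight N k) *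
      exp (- 2 * of_real pi * \<i> * of_real (y $ i * of_int k)))"
    by (simp add: fejer_kernel_def fejer_eq_exp)
  also have "\<dots> = (\<Sum>k\<in>PiE UNIV (\<lambda>_. {- int N..int N}). \<Prod>i\<in>UNIV. of_real (fejer_weight N (k i)) *
      exp (- 2 * of_real pi * \<i> * of_real (y $ i * of_int (k i))))"
    by (rule prod_sum_PiE) auto
  also have "\<dots> = (\<Sum>k\<in>PiE UNIV (\<lambda>_. {- int N..int N}). of_real (\<Prod>i\<in>UNIV. fejer_weight N (k i)) *
         exp (- 2 * of_real pi * \<i> * of_real (y \<bullet> ivec k)))"
    by (intro sum.cong refl)
       (simp add: prod.distrib exp_sum[symmetric] inner_vec_def sum_distrib_left)
  finally show ?thesis .
qed

lemma fejer_kernel_integral: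
  fixes g :: "real^'n \<Rightarrow> complex"
  assumes "rapidly_decreasing g"
  shows "(LINT y|lborel. fejer_kernel N y *\<^sub>R g y)
    = (\<Sum>k\<in>PiE UNIV (\<lambda>_. {- int N..int N}). of_real (\<Prod>i\<in>UNIV. fejer_weight N (k i)) * fourier g (ivec k))"
    and "integrable lborel (\<lambda>y. fejer_kernel N y *\<^sub>R g y)"
proof -
  let ?e = "\<lambda>k y. exp (- 2 * of_real pi * \<i> * of_real (y \<bullet> ivec k))"
  have [measurable]: "g \<in> borel_measurable borel"
    using assms by (rule rapidly_decreasing_measurable)
  have int: "integrable lborel (\<lambda>y. g y * ?e k y)" for k
    by (rule Bochner_Integration.integrable_bound[OF rapidly_decreasing_integrable[OF assms]])
       (auto simp: norm_mult)
  have eq: "fejer_kernel N y *\<^sub>R g y = (\<Sum>k\<in>PiE UNIV (\<lambda>_. {- int N..int N}).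
      of_real (\<Prod>i\<in>UNIV. fejer_weight N (k i)) * (g y * ?e k y))" for y
    unfolding scaleR_conv_of_real fejer_kernel_eq_exp sum_distrib_right by (simp add: mult_ac)
  show "(LINT y|lborel. fejer_kernel N y *\<^sub>R g y)
    = (\<Sum>k\<in>PiE UNIV (\<lambda>_. {- int N..int N}). of_real (\<Prod>i\<in>UNIV. fejer_weight N (k i)) * fourier g (ivec k))"
    unfolding eq fourier_def
    by (subst Bochner_Integration.integral_sum) (simp_all only: int integrable_mult_right integral_mult_right_zero)
  show "integrable lborel (\<lambda>y. fejer_kernel N y *\<^sub>R g y)"
    unfolding eq by (intro Bochner_Integration.integrable_sum integrable_mult_right int)
qed

text \<open>The finite sums are integrals of \<open>g\<close> against the kernel. Split over cubes,
  each piece tends to the value at the centre, and a summable bound independent of \<open>N\<close>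
  lets limit and sum be exchanged.\<close>

theorem fejer_poisson_summation:
  fixes g :: "real^'n \<Rightarrow> complex"
  assumes rd: "rapidly_decreasing g"
  shows "(\<lambda>N. \<Sum>k\<in>PiE UNIV (\<lambda>_. {- int N..int N}). of_real (\<Prod>i\<in>UNIV. fejer_weight N (k i)) * fourier g (ivec k))
    \<longlonglongrightarrow> (\<Sum>\<^sub>\<infinity>z. g (ivec z))"
proof -
  obtain C where C: "0 \<le> C" "\<And>y. norm (g y) \<le> C * (\<Prod>i\<in>UNIV. 1 / (1 + (y $ i)\<^sup>2))"
    using rd by (rule rapidly_decreasingE) blast
  have "norm (g y) \<le> C" for y
  proof -
    have "(\<Prod>i\<in>UNIV. 1 / (1 + (y $ i)\<^sup>2)) \<le> (\<Prod>i\<in>(UNIV::'n set). 1)"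
      by (intro prod_mono) (auto simp: divide_simps add_pos_nonneg)
    then show ?thesis
      using C(2)[of y] mult_left_mono[OF _ C(1)] by fastforce
  qed
  note lim = fejer_kernel_cube_tendsto[OF rapidly_decreasing_continuous[OF rd] this]
  define b where "b z = C * (\<Prod>i\<in>UNIV. 2 / (1 + (of_int (z i))\<^sup>2))" for z :: "'n \<Rightarrow> int"
  \<comment> \<open>Countable additivity and Tannery's theorem concern series over the naturals, so
    the integer vectors are enumerated.\<close>
  define en where "en = from_nat_into (UNIV :: ('n \<Rightarrow> int) set)"
  have inf: "infinite (UNIV :: ('n \<Rightarrow> int) set)"
  proof
    assume "finite (UNIV :: ('n \<Rightarrow> int) set)"
    then have "finite (range (\<lambda>m (_::'n). m :: int))"
      by (rule finite_subset[rotated]) auto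
    moreover have "inj (\<lambda>m (_::'n). m :: int)"
      by (auto intro!: injI dest: fun_cong)
    ultimately show False
      using finite_imageD infinite_UNIV_int by blast
  qed
  have bij: "bij_betw en UNIV UNIV"
    unfolding en_def using inf by (intro bij_betw_from_nat_into) auto
  define a where "a n N = (LINT y|lborel. (fejer_kernel N y * indicat_real (unit_cube (en n)) y) *\<^sub>R g y)" for n N
  have suminf: "(LINT y|lborel. fejer_kernel N y *\<^sub>R g y) = (\<Sum>n. a n N)" for N
  proof -
    have U: "(\<Union>n. unit_cube (en n)) = (UNIV :: (real^'n) set)"
      using bij by (auto simp: mem_unit_cube_iff bij_betw_def image_iff) (metis UNIV_I imageE)
    have "(LINT y:(\<Union>n. unit_cube (en n))|lborel. fejer_kernel N y *\<^sub>R g y)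
        = (\<Sum>n. LINT y:unit_cube (en n)|lborel. fejer_kernel N y *\<^sub>R g y)"
    proof (rule lebesgue_integral_countable_add)
      show "unit_cube (en i) \<inter> unit_cube (en j) = {}" if "i \<noteq> j" for i j
        using that bij by (auto simp: mem_unit_cube_iff bij_betw_def inj_on_def)
      show "set_integrable lborel (\<Union>n. unit_cube (en n)) (\<lambda>y. fejer_kernel N y *\<^sub>R g y)"
        unfolding U set_integrable_def using fejer_kernel_integral(2)[OF rd] by simp
    qed simp
    then show ?thesis
      by (simp add: U a_def set_lebesgue_integral_def mult.commute)
  qed
  \<comment> \<open>The kernel has mass exactly 1 on every cube for every \<open>N\<close>, so a
    bound for \<open>g\<close> on the cube suffices.\<close>
  have bound: "norm (a n N) \<le> b (en n)" for n N
  proof -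
    let ?k = "\<lambda>y. fejer_kernel N y * indicat_real (unit_cube (en n)) y"
    have hb: "has_bochner_integral lborel (\<lambda>y. b (en n) * ?k y) (b (en n) * 1)"
      by (intro has_bochner_integral_mult_right has_bochner_integral_fejer_kernel_cube)
    have "norm (a n N) \<le> (LINT y|lborel. b (en n) * ?k y)"
      unfolding a_def
    proof (rule lborel_integral_norm_le)
      show "integrable lborel (\<lambda>y. b (en n) * ?k y)"
        using hb by (simp add: has_bochner_integral_iff)
      show "norm (?k y *\<^sub>R g y) \<le> b (en n) * ?k y" for y
      proof (cases "y \<in> unit_cube (en n)")
        case True
        then have "norm (g y) \<le> b (en n)"
          unfolding b_def using C by (intro rapidly_decreasing_cube_bound)
        then show ?thesis
          using fejer_kernel_nonneg[of N y] by (simp add: abs_mult mult_right_mono mult.commute)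
      qed simp
    qed
    also have "\<dots> = b (en n)"
      using hb by (simp add: has_bochner_integral_iff)
    finally show ?thesis .
  qed
  have "summable (\<lambda>n. b (en n))"
  proof -
    have "b summable_on UNIV"
      unfolding b_def by (rule summable_on_cube_bound)
    then have "(\<lambda>n. b (en n)) summable_on UNIV"
      by (subst summable_on_reindex_bij_betw[OF bij])
    then show ?thesis
      by (rule summable_on_imp_summable)
  qed
  then have tan: "eventually (\<lambda>N. summable (\<lambda>n. norm (a n N))) sequentially \<and>
      summable (\<lambda>n. norm (g (ivec (en n)))) \<and> (\<lambda>N. \<Sum>n. a n N) \<longlonglongrightarrow> (\<Sum>n. g (ivec (en n)))"
    by (intro tannerys_theorem[where M = "\<lambda>n. b (en n)"])
       (use lim bound in \<open>auto simp: a_def intro!: always_eventually\<close>)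
  then have "((\<lambda>n. g (ivec (en n))) has_sum (\<Sum>n. g (ivec (en n)))) UNIV"
    by (intro norm_summable_imp_has_sum) (auto intro: summable_sums summable_norm_cancel)
  then have "(\<Sum>n. g (ivec (en n))) = (\<Sum>\<^sub>\<infinity>n. g (ivec (en n)))"
    by (simp add: infsumI)
  also have "\<dots> = (\<Sum>\<^sub>\<infinity>z. g (ivec z))"
    by (rule infsum_reindex_bij_betw[OF bij])
  finally show ?thesis
    using tan unfolding fejer_kernel_integral(1)[OF rd, symmetric] suminf by simp
qed

section \<open>Tightness of the linear programming bound\<close>

text \<open>One power of 1 + |y|^2 is spent on each coordinate. A bound in the norm is the starting
  point because rotations preserve it, unlike the product majorant.\<close>

lemma rapidly_decreasing_if_norm_bound:
  fixes g :: "real^'n \<Rightarrow> complex"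
  assumes cont: "continuous_on UNIV g" and le: "\<And>y. norm (g y) \<le> C / (1 + (norm y)\<^sup>2) ^ CARD('n)"
  shows "rapidly_decreasing g"
  unfolding rapidly_decreasing_def
proof (intro conjI cont exI allI)
  fix y
  have C: "0 \<le> C"
    using order_trans[OF norm_ge_zero le[of 0]] by simp
  have "norm (g y) \<le> C * (1 / (1 + (norm y)\<^sup>2) ^ CARD('n))"
    using le[of y] by simp
  also have "1 / (1 + (norm y)\<^sup>2) ^ CARD('n) = (\<Prod>i\<in>(UNIV::'n set). 1 / (1 + (norm y)\<^sup>2))"
    by (simp add: power_one_over)
  also have "C * \<dots> \<le> C * (\<Prod>i\<in>UNIV. 1 / (1 + (y $ i)\<^sup>2))"
  proof (intro mult_left_mono prod_mono conjI C)
    fix i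
    have "(y $ i)\<^sup>2 \<le> (norm y)\<^sup>2"
      using component_le_norm_cart[of y i] by (metis abs_ge_zero power2_abs power_mono)
    then show "1 / (1 + (norm y)\<^sup>2) \<le> 1 / (1 + (y $ i)\<^sup>2)"
      by (intro divide_left_mono mult_pos_pos add_pos_nonneg) auto
  qed simp
  finally show "norm (g y) \<le> C * (\<Prod>i\<in>UNIV. 1 / (1 + (y $ i)\<^sup>2))" .
qed

lemma schwartz_continuous:
  assumes "schwartz f"
  shows "continuous_on UNIV f"
proof -
  have "f differentiable (at x)" for x
    using assms unfolding schwartz_def by (metis iter_partial_deriv.simps(1))
  then show ?thesis
    by (simp add: continuous_on_eq_continuous_at differentiable_imp_continuous_within)
qed

lemma schwartz_decay:
  assumes "schwartz f"
  shows "\<exists>C. \<forall>y. \<bar>f y\<bar> \<le> C / (1 + (norm y)\<^sup>2) ^ n"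
proof -
  have "\<forall>k. \<exists>C. \<forall>x. norm x ^ k * \<bar>f x\<bar> \<le> C"
    using assms unfolding schwartz_def by (metis iter_partial_deriv.simps(1))
  then obtain A B where A: "\<And>x. norm x ^ 0 * \<bar>f x\<bar> \<le> A" and B: "\<And>x. norm x ^ (2 * n) * \<bar>f x\<bar> \<le> B"
    by metis
  have "\<bar>f y\<bar> \<le> 2 ^ n * (A + B) / (1 + (norm y)\<^sup>2) ^ n" for y
  proof -
    \<comment> \<open>Comparing 1 + r^2 with 2 * max 1 (r^2) leaves only the powers 0 and 2 * n of
      the norm, each controlled by one Schwartz bound.\<close>
    have "(1 + (norm y)\<^sup>2) ^ n \<le> (2 * max 1 ((norm y)\<^sup>2)) ^ n"
      by (intro power_mono) auto
    also have "\<dots> = 2 ^ n * (max 1 ((norm y)\<^sup>2)) ^ n"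
      by (rule power_mult_distrib)
    also have "\<dots> \<le> 2 ^ n * (1 + norm y ^ (2 * n))"
      by (intro mult_left_mono) (auto simp: max_def power_mult)
    finally have "(1 + (norm y)\<^sup>2) ^ n * \<bar>f y\<bar> \<le> 2 ^ n * (1 + norm y ^ (2 * n)) * \<bar>f y\<bar>"
      by (rule mult_right_mono) simp
    also have "\<dots> = 2 ^ n * (norm y ^ 0 * \<bar>f y\<bar> + norm y ^ (2 * n) * \<bar>f y\<bar>)"
      by (simp add: algebra_simps)
    also have "\<dots> \<le> 2 ^ n * (A + B)"
      by (intro mult_left_mono add_mono A B) simp
    finally have "\<bar>f y\<bar> * (1 + (norm y)\<^sup>2) ^ n \<le> 2 ^ n * (A + B)"
      by (simp only: mult.commute)
    moreover have "0 < (1 + (norm y)\<^sup>2) ^ n"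
      by (intro zero_less_power add_pos_nonneg) auto
    ultimately show ?thesis
      by (simp only: pos_le_divide_eq)
  qed
  then show ?thesis by blast
qed

lemma rapidly_decreasing_schwartz_orthogonal:
  fixes U :: "real^'n \<Rightarrow> real^'n"
  assumes f: "schwartz f" and U: "orthogonal_transformation U"
  shows "rapidly_decreasing (\<lambda>x. complex_of_real (f (U x)))"
proof -
  obtain C where "\<And>y. \<bar>f y\<bar> \<le> C / (1 + (norm y)\<^sup>2) ^ CARD('n)"
    using schwartz_decay[OF f] by blast
  then have "norm (complex_of_real (f (U y))) \<le> C / (1 + (norm y)\<^sup>2) ^ CARD('n)" for y
    using U by (metis norm_of_real orthogonal_transformation_norm)
  moreover have "continuous_on UNIV (\<lambda>x. complex_of_real (f (U x)))"
  proof (intro continuous_intros continuous_on_compose2[OF schwartz_continuous[OF f]] linear_continuous_on)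
    show "bounded_linear U"
      using U orthogonal_transformation_linear linear_linear by blast
  qed auto
  ultimately show ?thesis
    by (intro rapidly_decreasing_if_norm_bound)
qed

lemma rapidly_decreasing_translation:
  fixes g :: "real^'n \<Rightarrow> complex"
  assumes g: "rapidly_decreasing g" and w: "\<And>i. \<bar>w $ i\<bar> \<le> 1 / 2"
  shows "rapidly_decreasing (\<lambda>x. g (x + w))"
  unfolding rapidly_decreasing_def
proof (intro conjI)
  show "continuous_on UNIV (\<lambda>x. g (x + w))"
    by (intro continuous_intros continuous_on_compose2[OF rapidly_decreasing_continuous[OF g]]) auto
  obtain C where C: "0 \<le> C" "\<And>y. norm (g y) \<le> C * (\<Prod>i\<in>UNIV. 1 / (1 + (y $ i)\<^sup>2))"
    using g by (rule rapidly_decreasingE) blast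
  have "norm (g (y + w)) \<le> C * 2 ^ CARD('n) * (\<Prod>i\<in>UNIV. 1 / (1 + (y $ i)\<^sup>2))" for y
  proof -
    have "norm (g (y + w)) \<le> C * (\<Prod>i\<in>UNIV. 1 / (1 + (y $ i + w $ i)\<^sup>2))"
      using C(2)[of "y + w"] by simp
    also have "\<dots> \<le> C * (\<Prod>i\<in>UNIV. 2 / (1 + (y $ i)\<^sup>2))"
      by (intro mult_left_mono prod_mono conjI inverse_1_plus_square_shift w C) simp
    also have "(\<Prod>i\<in>UNIV. 2 / (1 + (y $ i)\<^sup>2)) = 2 ^ CARD('n) * (\<Prod>i\<in>UNIV. 1 / (1 + (y $ i)\<^sup>2))"
      by (simp add: prod_dividef)
    finally show ?thesis
      by (simp add: mult.assoc)
  qed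
  then show "\<exists>C. \<forall>y. norm (g (y + w)) \<le> C * (\<Prod>i\<in>UNIV. 1 / (1 + (y $ i)\<^sup>2))"
    by blast
qed

lemma rapidly_decreasing_modulation:
  fixes g :: "real^'n \<Rightarrow> complex"
  assumes g: "rapidly_decreasing g"
  shows "rapidly_decreasing (\<lambda>x. g x * exp (- 2 * of_real pi * \<i> * of_real (x \<bullet> w)))"
  unfolding rapidly_decreasing_def
proof (intro conjI)
  show "continuous_on UNIV (\<lambda>x. g x * exp (- 2 * of_real pi * \<i> * of_real (x \<bullet> w)))"
    by (intro continuous_intros rapidly_decreasing_continuous[OF g])
  have "norm (g y * exp (- 2 * of_real pi * \<i> * of_real (y \<bullet> w))) = norm (g y)" for y
    by (simp add: norm_mult)
  then show "\<exists>C. \<forall>y. norm (g y * exp (- 2 * of_real pi * \<i> * of_real (y \<bullet> w))) \<le> C * (\<Prod>i\<in>UNIV. 1 / (1 + (y $ i)\<^sup>2))"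
    using g by (simp only:) (simp add: rapidly_decreasing_def)
qed

lemma fourier_modulation:
  fixes w \<xi> :: "'a::euclidean_space"
  shows "fourier (\<lambda>x. g x * exp (- 2 * of_real pi * \<i> * of_real (x \<bullet> w))) \<xi> = fourier g (\<xi> + w)"
proof -
  have "exp (- 2 * of_real pi * \<i> * of_real (x \<bullet> w)) * exp (- 2 * of_real pi * \<i> * of_real (x \<bullet> \<xi>))
      = exp (- 2 * of_real pi * \<i> * of_real (x \<bullet> (\<xi> + w)))" for x :: 'a
    by (simp add: inner_add_right algebra_simps flip: exp_add)
  then show ?thesis
    unfolding fourier_def by (simp only: mult.assoc)
qed

section \<open>Gaussian sums over integer vectors\<close>

lemma norm_ivec_shift_square:
  "(norm (ivec z + w))\<^sup>2 = (\<Sum>i\<in>UNIV. (of_int (z i) + w $ i)\<^sup>2)"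
  unfolding power2_norm_eq_inner inner_vec_def by (simp add: power2_eq_square)

lemma ivec_eq_0_iff: "ivec z = 0 \<longleftrightarrow> z = (\<lambda>_. 0)"
  by (auto simp: Finite_Cartesian_Product.vec_eq_iff fun_eq_iff)

lemma exp_norm_ivec_shift:
  "exp (- t * (norm (ivec z + w))\<^sup>2) = (\<Prod>i\<in>UNIV. exp (- t * (of_int (z i) + w $ i)\<^sup>2))"
  by (simp add: norm_ivec_shift_square sum_distrib_left flip: exp_sum)

lemma summable_on_exp_norm_ivec:
  assumes "0 < t"
  shows "(\<lambda>z::'n::finite \<Rightarrow> int. exp (- t * (norm (ivec z))\<^sup>2)) summable_on UNIV"
proof -
  have "(\<lambda>z::'n \<Rightarrow> int. \<Prod>i\<in>UNIV. exp (- t * (of_int (z i))\<^sup>2)) summable_on UNIV"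
    by (intro summable_on_prod_fun summable_on_theta3 assms) simp
  then show ?thesis
    using exp_norm_ivec_shift[of t _ "0 :: real^'n"] by simp
qed

lemma infsum_prod_fun:
  fixes f :: "'i::finite \<Rightarrow> 'a \<Rightarrow> real"
  assumes "\<And>i. f i summable_on UNIV"
  shows "(\<Sum>\<^sub>\<infinity>z. \<Prod>i\<in>UNIV. f i (z i)) = (\<Prod>i\<in>UNIV. infsum (f i) UNIV)"
proof -
  have "(\<Sum>\<^sub>\<infinity>z\<in>PiE UNIV (\<lambda>_. UNIV). \<Prod>i\<in>UNIV. f i (z i)) = (\<Prod>i\<in>UNIV. infsum (f i) UNIV)"
    by (rule infsum_prod_PiE_abs) (simp_all only: finite iffD1[OF summable_on_iff_abs_summable_on_real assms])
  then show ?thesis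
    by simp
qed

lemma infsum_complex_of_real: "(\<Sum>\<^sub>\<infinity>x\<in>A. complex_of_real (f x)) = complex_of_real (infsum f A)"
proof (cases "f summable_on A")
  case True
  then show ?thesis
    by (intro infsumI has_sum_of_real has_sum_infsum)
next
  \<comment> \<open>Both infinite sums then have the default value 0.\<close>
  case False
  moreover from this have "\<not> (\<lambda>x. complex_of_real (f x)) summable_on A"
    using summable_on_Re by fastforce
  ultimately show ?thesis
    by (simp add: infsum_not_exists)
qed

lemma gaussian_mass_int_lattice:
  "gaussian_mass (int_lattice :: (real^'n) set) t = (\<Sum>\<^sub>\<infinity>z::'n \<Rightarrow> int. exp (- t * (norm (ivec z))\<^sup>2))"
proof -
  have inj: "inj (ivec :: ('n \<Rightarrow> int) \<Rightarrow> real^'n)"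
    by (auto intro!: injI simp: Finite_Cartesian_Product.vec_eq_iff fun_eq_iff)
  have eq: "int_lattice = range (ivec :: ('n \<Rightarrow> int) \<Rightarrow> real^'n)"
  proof (intro equalityI subsetI)
    fix x :: "real^'n" assume "x \<in> int_lattice"
    then have "\<forall>i. \<exists>k. x $ i = of_int k"
      by (auto simp: int_lattice_def elim: Ints_cases)
    then obtain z where "\<And>i. x $ i = of_int (z i)"
      by metis
    then have "x = ivec z"
      by (simp add: Finite_Cartesian_Product.vec_eq_iff)
    then show "x \<in> range ivec" by simp
  qed (auto simp: int_lattice_def)
  show ?thesis
    unfolding gaussian_mass_def eq infsum_reindex[OF inj] o_def ..
qed

section \<open>The equality case of the bound\<close>

text \<open>Let A be the sum of \<open>f\<close> over integer vectors, G the Gaussian sum and F the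
  transform. Then G - 1 + f 0 \<le> A by \<open>ge\<close> and A \<le> F 0 by \<open>le\<close>, and
  \<open>tight\<close> identifies the two ends, so no term on either side can have slack.\<close>

lemma poisson_tight:
  fixes f :: "real^'n \<Rightarrow> real"
  assumes t: "0 < t"
    and rd: "rapidly_decreasing (\<lambda>x. complex_of_real (f x))" and even: "\<And>x. f (- x) = f x"
    and ge: "\<And>z. z \<noteq> (\<lambda>_. 0) \<Longrightarrow> exp (- t * (norm (ivec z :: real^'n))\<^sup>2) \<le> f (ivec z)"
    and le: "\<And>z. z \<noteq> (\<lambda>_. 0) \<Longrightarrow> real_fourier f (ivec z) \<le> 0"
    and tight: "1 + real_fourier f 0 - f 0 = (\<Sum>\<^sub>\<infinity>z::'n \<Rightarrow> int. exp (- t * (norm (ivec z))\<^sup>2))"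
    and z: "z \<noteq> (\<lambda>_. 0)"
  shows "f (ivec z) = exp (- t * (norm (ivec z))\<^sup>2) \<and> real_fourier f (ivec z) = 0"
proof -
  have "(\<lambda>x. Re (complex_of_real (f x))) \<in> borel_measurable borel"
    using rapidly_decreasing_measurable[OF rd] by measurable
  then have "f \<in> borel_measurable borel"
    by simp
  note four = fourier_even_eq_real_fourier[OF this even]
  have ivec0: "ivec (\<lambda>_. 0) = (0 :: real^'n)"
    by (simp add: ivec_eq_0_iff)
  define P where "P N k = (\<Prod>i\<in>UNIV. fejer_weight N (k i))" for N and k :: "'n \<Rightarrow> int"
  define K where "K N = PiE UNIV (\<lambda>_::'n. {- int N..int N})" for N
  define A where "A = (\<Sum>\<^sub>\<infinity>z. f (ivec z))"
  define F where "F k = real_fourier f (ivec k)" for k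
  have K: "finite (K N)" "(\<lambda>_. 0) \<in> K N" for N
    by (auto simp: K_def intro: finite_PiE)
  have P0: "P N (\<lambda>_. 0) = 1" for N
    by (simp add: P_def fejer_weight_def)
  have P_nonneg: "0 \<le> P N k" if "k \<in> K N" for N k
    using that by (auto simp: P_def K_def intro!: prod_nonneg fejer_weight_nonneg)
  have f_sum: "(\<lambda>z. f (ivec z)) summable_on UNIV"
    using rapidly_decreasing_summable[OF rd] iffD2[OF summable_on_iff_abs_summable_on_real, of "\<lambda>z. f (ivec z)" UNIV]
    by simp
  have "(\<lambda>N. \<Sum>k\<in>K N. complex_of_real (P N k * F k)) \<longlonglongrightarrow> (\<Sum>\<^sub>\<infinity>z. complex_of_real (f (ivec z)))"
    using fejer_poisson_summation[OF rd] by (simp add: P_def K_def F_def four)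
  also have "(\<Sum>\<^sub>\<infinity>z. complex_of_real (f (ivec z))) = complex_of_real A"
    unfolding A_def by (rule infsum_complex_of_real)
  finally have lim: "(\<lambda>N. \<Sum>k\<in>K N. P N k * F k) \<longlonglongrightarrow> A"
    using tendsto_Re by fastforce
  have F_le: "F k \<le> 0" if "k \<noteq> (\<lambda>_. 0)" for k
    using le that by (simp add: F_def)
  \<comment> \<open>The weights are nonnegative and the coefficients away from 0 nonpositive, so
    each Fejer sum is already at most its term at 0.\<close>
  have "A \<le> F (\<lambda>_. 0)"
  proof (rule LIMSEQ_le_const2[OF lim], intro exI allI impI)
    fix N
    have "(\<Sum>k\<in>K N. P N k * F k) = F (\<lambda>_. 0) + (\<Sum>k\<in>K N - {\<lambda>_. 0}. P N k * F k)"
      using K by (subst sum.remove[of _ "\<lambda>_. 0"]) (auto simp: P0)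
    also have "(\<Sum>k\<in>K N - {\<lambda>_. 0}. P N k * F k) \<le> 0"
      by (intro sum_nonpos mult_nonneg_nonpos P_nonneg F_le) auto
    finally show "(\<Sum>k\<in>K N. P N k * F k) \<le> F (\<lambda>_. 0)" by simp
  qed
  define G where "G = (\<Sum>\<^sub>\<infinity>z::'n \<Rightarrow> int. exp (- t * (norm (ivec z))\<^sup>2))"
  have F0: "F (\<lambda>_. 0) = G - 1 + f 0"
    using tight by (simp add: F_def G_def ivec0)
  \<comment> \<open>\<open>D\<close> is the slack in \<open>ge\<close>; the last summand makes it 0
    at the origin, where \<open>ge\<close> says nothing.\<close>
  define D where "D z = f (ivec z) - exp (- t * (norm (ivec z))\<^sup>2) - (if z = (\<lambda>_. 0) then f 0 - 1 else 0)" for z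
  have delta: "((\<lambda>z::'n \<Rightarrow> int. if z = (\<lambda>_. 0) then f 0 - 1 else 0) has_sum f 0 - 1) UNIV"
  proof (rule has_sum_cong_neutral[THEN iffD1])
    show "((\<lambda>z::'n \<Rightarrow> int. f 0 - 1) has_sum f 0 - 1) {\<lambda>_. 0}"
      by (rule has_sum_finiteI) auto
  qed auto
  have D_sum: "(D has_sum A - G - (f 0 - 1)) UNIV"
    unfolding D_def diff_conv_add_uminus
    using f_sum summable_on_exp_norm_ivec[OF t] delta[unfolded diff_conv_add_uminus] unfolding A_def G_def
    by (intro has_sum_add has_sum_uminusI has_sum_infsum)
  moreover have D_nonneg: "0 \<le> D z" for z
    using ge[of z] by (auto simp: D_def ivec0)
  ultimately have "0 \<le> A - G - (f 0 - 1)"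
    by (blast intro: has_sum_nonneg)
  with \<open>A \<le> F (\<lambda>_. 0)\<close> F0 have A: "A = F (\<lambda>_. 0)"
    by simp
  then have "(D has_sum 0) UNIV"
    using D_sum F0 by simp
  then have "D z = 0"
    using D_nonneg by (intro nonneg_has_sum_le_0D[of D UNIV 0 z]) auto
  then have "f (ivec z) = exp (- t * (norm (ivec z))\<^sup>2)"
    using z by (simp add: D_def)
  \<comment> \<open>Keeping the term at \<open>z\<close>, whose weight tends to 1, sharpens the
    upper bound; as A = F 0, the nonpositive F z must vanish.\<close>
  moreover have "A \<le> F (\<lambda>_. 0) + 1 * F z"
  proof (rule LIMSEQ_le[OF lim])
    have "(\<lambda>N. P N z) \<longlonglongrightarrow> (\<Prod>i\<in>(UNIV::'n set). 1)"
      unfolding P_def by (intro tendsto_prod fejer_weight_tendsto)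
    then show "(\<lambda>N. F (\<lambda>_. 0) + P N z * F z) \<longlonglongrightarrow> F (\<lambda>_. 0) + 1 * F z"
      by (intro tendsto_intros) simp
    show "\<exists>M. \<forall>N\<ge>M. (\<Sum>k\<in>K N. P N k * F k) \<le> F (\<lambda>_. 0) + P N z * F z"
    proof (intro exI allI impI)
      \<comment> \<open>Such an \<open>N\<close> is at least |z i| for every i, so \<open>z\<close>
        is among the frequencies.\<close>
      fix N assume N: "nat (\<Sum>i\<in>UNIV. \<bar>z i\<bar>) \<le> N"
      have "\<bar>z i\<bar> \<le> int N" for i
        using member_le_sum[of i UNIV "\<lambda>i. \<bar>z i\<bar>"] N by simp
      then have zK: "z \<in> K N"
        by (auto simp: K_def abs_le_iff minus_le_iff)
      have "(\<Sum>k\<in>K N. P N k * F k) = F (\<lambda>_. 0) + (P N z * F z + (\<Sum>k\<in>K N - {\<lambda>_. 0} - {z}. P N k * F k))"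
        using K zK z sum.remove[of "K N" "\<lambda>_. 0" "\<lambda>k. P N k * F k"]
          sum.remove[of "K N - {\<lambda>_. 0}" z "\<lambda>k. P N k * F k"] by (simp add: P0)
      also have "(\<Sum>k\<in>K N - {\<lambda>_. 0} - {z}. P N k * F k) \<le> 0"
        by (intro sum_nonpos mult_nonneg_nonpos P_nonneg F_le) auto
      finally show "(\<Sum>k\<in>K N. P N k * F k) \<le> F (\<lambda>_. 0) + P N z * F z" by simp
    qed
  qed
  then have "real_fourier f (ivec z) = 0"
    using A le[OF z] by (simp add: F_def)
  ultimately show ?thesis ..
qed

section \<open>The half-integral shift\<close>

text \<open>On \<open>S\<close> the doubled coordinates 2 * z i + 1 are odd, so integers with a
  quarter of their square sum can replace the shifted coordinates. The norm is not 0, as a half-odd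
  coordinate never vanishes.\<close>

lemma exists_ivec_same_norm:
  fixes z :: "'n::finite \<Rightarrow> int"
  assumes S: "card S = 8"
  defines "w \<equiv> (\<chi> i. if i \<in> S then 1 / 2 else 0)"
  shows "\<exists>z'::'n \<Rightarrow> int. z' \<noteq> (\<lambda>_. 0) \<and> norm (ivec z') = norm (ivec z + w)"
proof -
  have "\<exists>y::'n \<Rightarrow> int. 4 * (\<Sum>i\<in>S. (y i)\<^sup>2) = (\<Sum>i\<in>S. (2 * z i + 1)\<^sup>2)"
    by (rule odd_squares_card_8[OF S]) simp
  then obtain y :: "'n \<Rightarrow> int" where y: "4 * (\<Sum>i\<in>S. (y i)\<^sup>2) = (\<Sum>i\<in>S. (2 * z i + 1)\<^sup>2)" ..
  define z' where "z' i = (if i \<in> S then y i else z i)" for i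
  have split: "(\<Sum>i\<in>UNIV. g i) = (\<Sum>i\<in>S. g i) + (\<Sum>i\<in>- S. g i)" for g :: "'n \<Rightarrow> real"
    using sum.subset_diff[of S UNIV g] by (simp add: Compl_eq_Diff_UNIV add.commute)
  have "4 * (\<Sum>i\<in>S. (real_of_int (y i))\<^sup>2) = (\<Sum>i\<in>S. (2 * real_of_int (z i) + 1)\<^sup>2)"
    using arg_cong[OF y, of real_of_int] by simp
  also have "\<dots> = 4 * (\<Sum>i\<in>S. (real_of_int (z i) + 1 / 2)\<^sup>2)"
    unfolding sum_distrib_left by (intro sum.cong refl) (simp add: power2_eq_square algebra_simps)
  finally have eq: "(norm (ivec z'))\<^sup>2 = (norm (ivec z + w))\<^sup>2"
    using norm_ivec_shift_square[of z' 0] norm_ivec_shift_square[of z w]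
    by (simp add: split z'_def w_def)
  obtain i where "i \<in> S"
    using S by fastforce
  have "2 * z i + 1 \<noteq> 0"
    by presburger
  then have "real_of_int (2 * z i + 1) \<noteq> 0"
    by (simp only: of_int_eq_0_iff not_False_eq_True)
  then have "(ivec z + w) $ i \<noteq> 0"
    using \<open>i \<in> S\<close> by (simp add: w_def field_simps)
  then have "norm (ivec z + w) \<noteq> 0"
    by (metis norm_eq_zero zero_index)
  then have "z' \<noteq> (\<lambda>_. 0)"
    using eq by (metis ivec_eq_0_iff norm_zero power_eq_0_iff zero_power2)
  then show ?thesis
    using eq by auto
qed

text \<open>Pairing with the half-vector gives half an integer, so the character is a sign; this is
  the source of the alternation in \<open>theta4\<close>.\<close>

lemma exp_half_shift:
  fixes S :: "'n::finite set"
  shows "exp (- 2 * of_real pi * \<i> * of_real (ivec z \<bullet> (\<chi> i. if i \<in> S then 1 / 2 else 0)))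
    = complex_of_real (\<Prod>i\<in>UNIV. if i \<in> S \<and> odd (z i) then - 1 else 1)"
proof -
  have "exp (- (of_real pi * \<i> * of_int m)) = (if odd m then - 1 else 1)" for m :: int
  proof -
    have "- (of_real pi * \<i> * of_int m) = \<i> * of_real (- (pi * of_int m))"
      by simp
    then have "exp (- (of_real pi * \<i> * of_int m)) = cis (- (pi * of_int m))"
      by (simp only: cis_conv_exp)
    also have "\<dots> = (if odd m then - 1 else 1)"
    proof -
      have "sin (pi * of_int m) = 0"
        using sin_times_pi_eq_0[of "of_int m :: real"] by (simp add: mult.commute)
      moreover have "cos (pi * of_int m) = (if odd m then - 1 else 1)"
        using cos_npi_int[of m] by auto
      ultimately show ?thesis
        by (simp add: complex_eq_iff)
    qed
    finally show ?thesis .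
  qed
  then have "exp (- 2 * of_real pi * \<i> * of_real (of_int (z i) * (if i \<in> S then 1 / 2 else 0)))
      = complex_of_real (if i \<in> S \<and> odd (z i) then - 1 else 1)" for i
    by (auto simp: mult.assoc)
  then show ?thesis
    unfolding inner_vec_def by (simp add: sum_distrib_left exp_sum)
qed

text \<open>All three sums factor over the coordinates, and those outside \<open>S\<close>
  contribute the same positive power of theta3, which is 1 if there are none. What remains is
  \<open>theta_power8_less\<close>.\<close>

lemma shifted_gaussian_sum_less:
  fixes S :: "'n::finite set"
  assumes t: "0 < t" and S: "card S = 8"
  defines "w \<equiv> (\<chi> i. if i \<in> S then 1 / 2 else 0)"
  shows "(\<Sum>\<^sub>\<infinity>z. exp (- t * (norm (ivec z + w))\<^sup>2))
       + (\<Sum>\<^sub>\<infinity>z. (\<Prod>i\<in>UNIV. if i \<in> S \<and> odd (z i) then - 1 else 1) * exp (- t * (norm (ivec z :: real^'n))\<^sup>2))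
     < (\<Sum>\<^sub>\<infinity>z. exp (- t * (norm (ivec z :: real^'n))\<^sup>2))"
proof -
  have card: "(\<Prod>i\<in>(UNIV::'n set). if i \<in> S then a else b) = a ^ 8 * b ^ card (- S)" for a b :: real
    using prod.subset_diff[of S UNIV "\<lambda>i. if i \<in> S then a else b"] S
    by (simp add: Compl_eq_Diff_UNIV mult.commute)
  have A: "(\<Sum>\<^sub>\<infinity>z. exp (- t * (norm (ivec z :: real^'n))\<^sup>2)) = theta3 t ^ 8 * theta3 t ^ card (- S)"
  proof -
    have "(\<Sum>\<^sub>\<infinity>z. exp (- t * (norm (ivec z :: real^'n))\<^sup>2)) = (\<Sum>\<^sub>\<infinity>z. \<Prod>i\<in>(UNIV::'n set). exp (- t * (of_int (z i))\<^sup>2))"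
      using exp_norm_ivec_shift[of t _ "0 :: real^'n"] by simp
    also have "\<dots> = (\<Prod>i\<in>(UNIV::'n set). if i \<in> S then theta3 t else theta3 t)"
      by (subst infsum_prod_fun) (use summable_on_theta3[OF t] in \<open>auto simp: theta3_def\<close>)
    finally show ?thesis
      unfolding card .
  qed
  have B: "(\<Sum>\<^sub>\<infinity>z. (\<Prod>i\<in>UNIV. if i \<in> S \<and> odd (z i) then - 1 else 1) * exp (- t * (norm (ivec z :: real^'n))\<^sup>2))
      = theta4 t ^ 8 * theta3 t ^ card (- S)"
  proof -
    let ?f = "\<lambda>i m. (if i \<in> S \<and> odd m then - 1 else 1) * exp (- t * (of_int m)\<^sup>2)"
    have fS: "?f i = (\<lambda>m. (if even m then 1 else - 1) * exp (- t * (of_int m)\<^sup>2))" if "i \<in> S" for i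
      using that by (auto simp: fun_eq_iff)
    have fN: "?f i = (\<lambda>m. exp (- t * (of_int m)\<^sup>2))" if "i \<notin> S" for i
      using that by (auto simp: fun_eq_iff)
    have f: "?f i summable_on UNIV \<and> infsum (?f i) UNIV = (if i \<in> S then theta4 t else theta3 t)" for i
    proof (cases "i \<in> S")
      case True
      then show ?thesis
        using summable_on_theta4[OF t] unfolding fS[OF True] theta4_def by simp
    next
      case False
      then show ?thesis
        using summable_on_theta3[OF t] unfolding fN[OF False] theta3_def by simp
    qed
    have "(\<Sum>\<^sub>\<infinity>z. (\<Prod>i\<in>UNIV. if i \<in> S \<and> odd (z i) then - 1 else 1) * exp (- t * (norm (ivec z :: real^'n))\<^sup>2))
        = (\<Sum>\<^sub>\<infinity>z. \<Prod>i\<in>UNIV. ?f i (z i))"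
      using exp_norm_ivec_shift[of t _ "0 :: real^'n"] by (simp add: prod.distrib)
    also have "\<dots> = (\<Prod>i\<in>UNIV. infsum (?f i) UNIV)"
      by (rule infsum_prod_fun) (rule conjunct1[OF f])
    also have "\<dots> = (\<Prod>i\<in>UNIV. if i \<in> S then theta4 t else theta3 t)"
      by (intro prod.cong refl conjunct2[OF f])
    finally show ?thesis
      unfolding card .
  qed
  have C: "(\<Sum>\<^sub>\<infinity>z. exp (- t * (norm (ivec z + w))\<^sup>2)) = theta2 t ^ 8 * theta3 t ^ card (- S)"
  proof -
    let ?f = "\<lambda>i m. exp (- t * (of_int m + w $ i)\<^sup>2)"
    have f: "?f i summable_on UNIV" "infsum (?f i) UNIV = (if i \<in> S then theta2 t else theta3 t)" for i
      using summable_on_theta3[OF t] summable_on_theta2[OF t]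
      by (cases "i \<in> S"; simp add: theta3_def theta2_def w_def)+
    have "(\<Sum>\<^sub>\<infinity>z. exp (- t * (norm (ivec z + w))\<^sup>2)) = (\<Prod>i\<in>UNIV. if i \<in> S then theta2 t else theta3 t)"
      unfolding exp_norm_ivec_shift by (subst infsum_prod_fun) (simp_all only: f)
    then show ?thesis
      unfolding card .
  qed
  have "0 < theta3 t ^ card (- S)"
    using theta3_pos[OF t] by simp
  from mult_strict_right_mono[OF theta_power8_less[OF t] this] show ?thesis
    unfolding A B C by (simp only: distrib_right)
qed

section \<open>The contradiction\<close>

theorem theorem5p2:
  fixes t :: real
    and h :: "(real^'n) set \<Rightarrow> real^'n \<Rightarrow> real"
    and e :: "8 \<Rightarrow> 'n"
  assumes "8 \<le> CARD('n)" and "0 < t" and "inj e"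
    and "\<And>L. stable L \<Longrightarrow> schwartz (h L)"
    and "\<And>L x. stable L \<Longrightarrow> h L (- x) = h L x"
    and "\<And>L U. stable L \<Longrightarrow> orthogonal_transformation U \<Longrightarrow> h (U ` L) = h L"
    and "\<And>L x. stable L \<Longrightarrow> x \<in> L \<Longrightarrow> x \<noteq> 0 \<Longrightarrow> exp (- t * (norm x)\<^sup>2) \<le> h L x"
    and "\<And>L \<xi>. stable L \<Longrightarrow> \<xi> \<in> dual_lattice L \<Longrightarrow> \<xi> \<noteq> 0 \<Longrightarrow> real_fourier (h L) \<xi> \<le> 0"
    and "1 + real_fourier (h int_lattice) 0 - h int_lattice 0
           = gaussian_mass (int_lattice :: (real^'n) set) t"
  shows "1 + real_fourier (h (E8_sum_int e)) 0 - h (E8_sum_int e) 0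
           > gaussian_mass (int_lattice :: (real^'n) set) t"
proof -
  define H where "H = h int_lattice"
  have stU: "stable (U ` int_lattice)" if "orthogonal_transformation U" for U :: "real^'n \<Rightarrow> real^'n"
    using that by (rule stable_orthogonal_image_int_lattice)
  have st: "stable (int_lattice :: (real^'n) set)"
    using stU[OF orthogonal_transformation_id] by simp
  have HU: "h (U ` int_lattice) = H" if "orthogonal_transformation U" for U :: "real^'n \<Rightarrow> real^'n"
    unfolding H_def using assms(6)[OF st that] .
  have sch: "schwartz H" and even: "\<And>x. H (- x) = H x"
    unfolding H_def using assms(4,5) st by auto
  have rd: "rapidly_decreasing (\<lambda>x. complex_of_real (H x))"
    using rapidly_decreasing_schwartz_orthogonal[OF sch orthogonal_transformation_id] by simp
  have Hmeas: "H \<in> borel_measurable borel"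
    using schwartz_continuous[OF sch] by (rule borel_measurable_continuous_onI)
  then have Hmeas': "(\<lambda>x. complex_of_real (H x)) \<in> borel_measurable borel"
    by measurable
  note four = fourier_even_eq_real_fourier[OF Hmeas even]
  have gm: "gaussian_mass (int_lattice :: (real^'n) set) t = (\<Sum>\<^sub>\<infinity>z::'n \<Rightarrow> int. exp (- t * (norm (ivec z))\<^sup>2))"
    by (rule gaussian_mass_int_lattice)
  have tight: "1 + real_fourier H 0 - H 0 = (\<Sum>\<^sub>\<infinity>z::'n \<Rightarrow> int. exp (- t * (norm (ivec z))\<^sup>2))"
    using assms(9) by (simp add: H_def gm)
  have ivec_mem: "ivec z \<in> (int_lattice :: (real^'n) set)" for z
    by (simp add: int_lattice_def)
  \<comment> \<open>Some orthogonal U maps the integer vector to \<open>x\<close>. By (a) the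
    rotated lattice has the function \<open>H\<close> again, so the composition of \<open>H\<close>
    with U satisfies the assumptions of \<open>poisson_tight\<close>, whose conclusion at
    \<open>z\<close> is the claim at \<open>x\<close>.\<close>
  have key: "H x = exp (- t * (norm x)\<^sup>2) \<and> real_fourier H x = 0"
    if z: "z \<noteq> (\<lambda>_. 0)" and nx: "norm (ivec z) = norm x" for x :: "real^'n" and z :: "'n \<Rightarrow> int"
  proof -
    obtain U where U: "orthogonal_transformation U" "U (ivec z) = x"
      using orthogonal_transformation_exists[OF nx] by blast
    have lin: "linear U" and nU: "\<And>y. norm (U y) = norm y"
      using U(1) by (simp_all add: orthogonal_transformation_linear orthogonal_transformation_norm)
    have Uz: "U (ivec k) \<noteq> 0" if "k \<noteq> (\<lambda>_. 0)" for k
      using that nU[of "ivec k"] by (metis ivec_eq_0_iff norm_eq_zero)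
    have rf: "real_fourier (\<lambda>y. H (U y)) \<xi> = real_fourier H (U \<xi>)" for \<xi>
      unfolding real_fourier_def using fourier_orthogonal_transformation[OF U(1) Hmeas'] by simp
    have "H (U (ivec z)) = exp (- t * (norm (ivec z :: real^'n))\<^sup>2) \<and> real_fourier (\<lambda>y. H (U y)) (ivec z) = 0"
    proof (rule poisson_tight[OF assms(2), where f = "\<lambda>y. H (U y)"])
      show "rapidly_decreasing (\<lambda>y. complex_of_real (H (U y)))"
        by (rule rapidly_decreasing_schwartz_orthogonal[OF sch U(1)])
      show "H (U (- y)) = H (U y)" for y
        by (simp add: linear_neg[OF lin] even)
      show "exp (- t * (norm (ivec k :: real^'n))\<^sup>2) \<le> H (U (ivec k))" if "k \<noteq> (\<lambda>_. 0)" for k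
        using assms(7)[OF stU[OF U(1)] imageI[OF ivec_mem] Uz[OF that]] by (simp add: HU[OF U(1)] nU)
      show "real_fourier (\<lambda>y. H (U y)) (ivec k) \<le> 0" if "k \<noteq> (\<lambda>_. 0)" for k
        using assms(8)[OF stU[OF U(1)] _ Uz[OF that]] orthogonal_image_int_lattice_subset_dual[OF U(1)] ivec_mem[of k]
        by (auto simp: HU[OF U(1)] rf)
      show "1 + real_fourier (\<lambda>y. H (U y)) 0 - H (U 0) = (\<Sum>\<^sub>\<infinity>z::'n \<Rightarrow> int. exp (- t * (norm (ivec z))\<^sup>2))"
        using tight by (simp add: rf linear_0[OF lin])
    qed (rule z)
    then show ?thesis
      by (simp add: rf U(2) nx)
  qed
  define S where "S = range e"
  have S: "card S = 8"
    using card_image[OF assms(3)] by (simp add: S_def)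
  define w :: "real^'n" where "w = (\<chi> i. if i \<in> S then 1 / 2 else 0)"
  have shifted: "H (ivec z + w) = exp (- t * (norm (ivec z + w))\<^sup>2)" "real_fourier H (ivec z + w) = 0" for z
    using exists_ivec_same_norm[OF S, of z] key unfolding w_def by blast+
  \<comment> \<open>After translation by \<open>w\<close> the lattice side runs over ivec z + w,
    where \<open>H\<close> is Gaussian. A coefficient at k \<noteq> 0 is a phase times the transform
    at ivec k, hence 0, so every Fejer sum is just its term at k = 0, of weight 1.\<close>
  have C: "real_fourier H 0 = (\<Sum>\<^sub>\<infinity>z. exp (- t * (norm (ivec z + w))\<^sup>2))"
  proof -
    have "rapidly_decreasing (\<lambda>x. complex_of_real (H (x + w)))"
      by (rule rapidly_decreasing_translation[OF rd]) (simp add: w_def)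
    from fejer_poisson_summation[OF this]
    have "(\<lambda>N. \<Sum>k\<in>PiE UNIV (\<lambda>_. {- int N..int N}). of_real (\<Prod>i\<in>UNIV. fejer_weight N (k i)) *
          fourier (\<lambda>x. complex_of_real (H (x + w))) (ivec k))
        \<longlonglongrightarrow> (\<Sum>\<^sub>\<infinity>z. complex_of_real (exp (- t * (norm (ivec z + w))\<^sup>2)))"
      by (simp only: shifted)
    moreover have "(\<Sum>k\<in>PiE UNIV (\<lambda>_. {- int N..int N}). of_real (\<Prod>i\<in>UNIV. fejer_weight N (k i)) *
          fourier (\<lambda>x. complex_of_real (H (x + w))) (ivec k)) = complex_of_real (real_fourier H 0)" for N
    proof -
      have "of_real (\<Prod>i\<in>UNIV. fejer_weight N (k i)) * fourier (\<lambda>x. complex_of_real (H (x + w))) (ivec k)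
          = (if k = (\<lambda>_. 0) then complex_of_real (real_fourier H 0) else 0)" for k
      proof (cases "k = (\<lambda>_. 0)")
        case True
        then have "ivec k = 0"
          by (simp add: ivec_eq_0_iff)
        then show ?thesis
          using True by (simp add: fourier_translation[OF Hmeas'] four fejer_weight_def)
      next
        case False
        then show ?thesis
          using key[OF False refl] by (simp add: fourier_translation[OF Hmeas'] four)
      qed
      moreover have "(\<lambda>_. 0) \<in> PiE UNIV (\<lambda>_::'n. {- int N..int N})"
        by auto
      ultimately show ?thesis
        by (simp add: finite_PiE)
    qed
    ultimately have "complex_of_real (real_fourier H 0) = (\<Sum>\<^sub>\<infinity>z. complex_of_real (exp (- t * (norm (ivec z + w))\<^sup>2)))"
      by (simp add: LIMSEQ_const_iff)
    also have "\<dots> = complex_of_real (\<Sum>\<^sub>\<infinity>z. exp (- t * (norm (ivec z + w))\<^sup>2))"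
      by (rule infsum_complex_of_real)
    finally show ?thesis
      by (simp only: of_real_eq_iff)
  qed
  define s where "s z = (\<Prod>i\<in>UNIV. if i \<in> S \<and> odd (z i) then - 1 else 1 :: real)" for z :: "'n \<Rightarrow> int"
  have abs_s: "\<bar>s z\<bar> = 1" for z
    unfolding s_def abs_prod by (intro prod.neutral) auto
  \<comment> \<open>Modulation by \<open>w\<close> moves all coefficients to points ivec k + w,
    where the transform vanishes, so the signed sum of \<open>H\<close> is 0.\<close>
  have B: "(\<Sum>\<^sub>\<infinity>z. s z * exp (- t * (norm (ivec z :: real^'n))\<^sup>2)) = 1 - H 0"
  proof -
    have "fourier (\<lambda>x. complex_of_real (H x) * exp (- 2 * of_real pi * \<i> * of_real (x \<bullet> w))) (ivec k) = 0" for k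
      unfolding fourier_modulation four shifted(2) by simp
    with fejer_poisson_summation[OF rapidly_decreasing_modulation[OF rd, of w]]
    have "(\<Sum>\<^sub>\<infinity>z. complex_of_real (H (ivec z)) * exp (- 2 * of_real pi * \<i> * of_real (ivec z \<bullet> w))) = 0"
      by (simp add: LIMSEQ_const_iff)
    then have "(\<Sum>\<^sub>\<infinity>z. complex_of_real (H (ivec z) * s z)) = 0"
      unfolding w_def exp_half_shift s_def by simp
    then have zero: "(\<Sum>\<^sub>\<infinity>z. H (ivec z) * s z) = 0"
      by (simp only: infsum_complex_of_real of_real_eq_0_iff)
    have "(\<lambda>z. norm (H (ivec z) * s z)) summable_on UNIV"
      using rapidly_decreasing_summable[OF rd] by (simp add: abs_mult abs_s)
    then have "(\<lambda>z. H (ivec z) * s z) summable_on UNIV"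
      by (rule abs_summable_summable)
    then have "((\<lambda>z. H (ivec z) * s z) has_sum 0) UNIV"
      using zero by (metis has_sum_infsum)
    \<comment> \<open>The values at nonzero integer vectors are Gaussian. At the origin, where
      \<open>s\<close> is 1, adding 1 - H 0 supplies the Gaussian value 1.\<close>
    moreover have "((\<lambda>z::'n \<Rightarrow> int. if z = (\<lambda>_. 0) then 1 - H 0 else 0) has_sum 1 - H 0) UNIV"
    proof (rule has_sum_cong_neutral[THEN iffD1])
      show "((\<lambda>z::'n \<Rightarrow> int. 1 - H 0) has_sum 1 - H 0) {\<lambda>_. 0}"
        by (rule has_sum_finiteI) auto
    qed auto
    ultimately have "((\<lambda>z. H (ivec z) * s z + (if z = (\<lambda>_. 0) then 1 - H 0 else 0)) has_sum 0 + (1 - H 0)) UNIV"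
      by (rule has_sum_add)
    moreover have "H (ivec z) * s z + (if z = (\<lambda>_. 0) then 1 - H 0 else 0) = s z * exp (- t * (norm (ivec z))\<^sup>2)" for z
    proof (cases "z = (\<lambda>_. 0)")
      case True
      then have "ivec z = 0"
        by (simp add: ivec_eq_0_iff)
      then show ?thesis
        using True by (simp add: s_def)
    qed (simp add: key[OF _ refl])
    ultimately show ?thesis
      by (simp add: infsumI)
  qed
  \<comment> \<open>Up to order, the left side here is that of \<open>tight\<close>, which asserts
    equality.\<close>
  have "real_fourier H 0 + (1 - H 0) < (\<Sum>\<^sub>\<infinity>z::'n \<Rightarrow> int. exp (- t * (norm (ivec z))\<^sup>2))"
    using shifted_gaussian_sum_less[OF assms(2) S] B C unfolding w_def s_def by simp
  then show ?thesis
    using tight by simp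
qed

end
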